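(* Let $G$ be a finite group and let $B_0(G)=\ker\{H^2(G,\mathbb{Q}/\mathbb{Z})\to\bigoplus_A H^2(A,\mathbb{Q}/\mathbb{Z})\}$ be its Bogomolov multiplier, where $A$ runs over all abelian subgroups of $G$. If $B_0(G)=0$, then $\mathrm{exp}(H_2(G,\mathbb{Z}))$ divides $\mathrm{exp}(G)$.
   Context: For a group $K$, $\mathrm{exp}(K)$ denotes the exponent of $K$, i.e. the smallest positive integer $n$ such that $g^n=1$ for all $g\in K$. $H_2(G,\mathbb{Z})$ is the second homology group of $G$ with coefficients in $\mathbb{Z}$ (trivial action), i.e. the Schur multiplier of $G$. $H^2(G,\mathbb{Q}/\mathbb{Z})$ and $H^2(A,\mathbb{Q}/\mathbb{Z})$ are second group cohomology groups with coefficients in $\mathbb{Q}/\mathbb{Z}$ with trivial action, and the map $H^2(G,\mathbb{Q}/\mathbb{Z})\to\bigoplus_A H^2(A,\mathbb{Q}/\mathbb{Z})$ is the one whose components are the restriction maps to the abelian subgroups $A$ of $G$. *)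

theory Defs
  imports "HOL-Algebra.Free_Abelian_Groups"
begin

text \<open>The value is \<open>0\<close> when no positive exponent exists, so \<open>group_exponent K dvd n\<close> with \<open>n > 0\<close>
  includes that \<open>K\<close> has finite exponent.\<close>

definition group_exponent :: "('a, 'b) monoid_scheme \<Rightarrow> nat" where
  "group_exponent K =
     (if \<exists>n::nat>0. \<forall>g\<in>carrier K. g [^]\<^bsub>K\<^esub> n = \<one>\<^bsub>K\<^esub>
      then LEAST n::nat. n > 0 \<and> (\<forall>g\<in>carrier K. g [^]\<^bsub>K\<^esub> n = \<one>\<^bsub>K\<^esub>)
      else 0)"

text \<open>
  Homology and cohomology with trivial coefficients are taken from the inhomogeneous (bar)
  complex. A list \<open>[g\<^sub>1, \<dots>, g\<^sub>n]\<close> over the carrier stands for the basis element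
  \<open>[g\<^sub>1 | \<dots> | g\<^sub>n]\<close>; its faces are \<open>[g\<^sub>2 | \<dots> | g\<^sub>n]\<close> for \<open>i = 0\<close>,
  \<open>[g\<^sub>1 | \<dots> | g\<^sub>i \<otimes> g\<^sub>i\<^sub>+\<^sub>1 | \<dots> | g\<^sub>n]\<close> for \<open>0 < i < n\<close>, and \<open>[g\<^sub>1 | \<dots> | g\<^sub>n\<^sub>-\<^sub>1]\<close>
  for \<open>i = n\<close>. As the action is trivial, the \<open>0\<close>-th face carries no operator \<open>g\<^sub>1\<close>.
\<close>

definition bar_basis :: "('a, 'b) monoid_scheme \<Rightarrow> nat \<Rightarrow> 'a list set" where
  "bar_basis G n = {xs. length xs = n \<and> set xs \<subseteq> carrier G}"

definition bar_face :: "('a, 'b) monoid_scheme \<Rightarrow> nat \<Rightarrow> 'a list \<Rightarrow> 'a list" where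
  "bar_face G i xs =
     (if i = 0 then tl xs
      else if i = length xs then butlast xs
      else take (i - 1) xs @ [xs ! (i - 1) \<otimes>\<^bsub>G\<^esub> xs ! i] @ drop (i + 1) xs)"


subsection \<open>Homology with coefficients in \<open>\<int>\<close>\<close>

definition bar_chain_group :: "('a, 'b) monoid_scheme \<Rightarrow> nat \<Rightarrow> ('a list \<Rightarrow>\<^sub>0 int) monoid" where
  "bar_chain_group G n = free_Abelian_group (bar_basis G n)"

definition bar_boundary ::
    "('a, 'b) monoid_scheme \<Rightarrow> nat \<Rightarrow> ('a list \<Rightarrow>\<^sub>0 int) \<Rightarrow> ('a list \<Rightarrow>\<^sub>0 int)" where
  "bar_boundary G n c =
     (if n = 0 then 0
      else frag_extend (\<lambda>xs. \<Sum>i\<le>n. frag_cmul ((- 1) ^ i) (frag_of (bar_face G i xs))) c)"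

definition integral_cycles :: "('a, 'b) monoid_scheme \<Rightarrow> nat \<Rightarrow> ('a list \<Rightarrow>\<^sub>0 int) set" where
  "integral_cycles G n =
     kernel (bar_chain_group G n) (bar_chain_group G (n - 1)) (bar_boundary G n)"

definition integral_boundaries :: "('a, 'b) monoid_scheme \<Rightarrow> nat \<Rightarrow> ('a list \<Rightarrow>\<^sub>0 int) set" where
  "integral_boundaries G n = bar_boundary G (n + 1) ` carrier (bar_chain_group G (n + 1))"

definition integral_homology_group ::
    "('a, 'b) monoid_scheme \<Rightarrow> nat \<Rightarrow> ('a list \<Rightarrow>\<^sub>0 int) set monoid" where
  "integral_homology_group G n =
     (bar_chain_group G n)\<lparr>carrier := integral_cycles G n\<rparr> Mod integral_boundaries G n"


subsection \<open>Cohomology with coefficients in a commutative group \<open>M\<close> (trivial action)\<close>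

definition cochain_group ::
    "('a, 'b) monoid_scheme \<Rightarrow> ('m, 'c) monoid_scheme \<Rightarrow> nat \<Rightarrow> ('a list \<Rightarrow> 'm) monoid" where
  "cochain_group G M n = product_group (bar_basis G n) (\<lambda>_. M)"

definition coboundary_map ::
    "('a, 'b) monoid_scheme \<Rightarrow> ('m, 'c) monoid_scheme \<Rightarrow> nat \<Rightarrow> ('a list \<Rightarrow> 'm) \<Rightarrow> ('a list \<Rightarrow> 'm)"
  where
  "coboundary_map G M n f =
     (\<lambda>xs\<in>bar_basis G (n + 1).
        \<Otimes>\<^bsub>M\<^esub>i\<in>{..n + 1}. f (bar_face G i xs) [^]\<^bsub>M\<^esub> ((- 1) ^ i :: int))"

definition cocycles ::
    "('a, 'b) monoid_scheme \<Rightarrow> ('m, 'c) monoid_scheme \<Rightarrow> nat \<Rightarrow> ('a list \<Rightarrow> 'm) set" where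
  "cocycles G M n = kernel (cochain_group G M n) (cochain_group G M (n + 1)) (coboundary_map G M n)"

definition coboundaries ::
    "('a, 'b) monoid_scheme \<Rightarrow> ('m, 'c) monoid_scheme \<Rightarrow> nat \<Rightarrow> ('a list \<Rightarrow> 'm) set" where
  "coboundaries G M n =
     (if n = 0 then {\<one>\<^bsub>cochain_group G M n\<^esub>}
      else coboundary_map G M (n - 1) ` carrier (cochain_group G M (n - 1)))"

definition cocycle_group ::
    "('a, 'b) monoid_scheme \<Rightarrow> ('m, 'c) monoid_scheme \<Rightarrow> nat \<Rightarrow> ('a list \<Rightarrow> 'm) monoid" where
  "cocycle_group G M n = (cochain_group G M n)\<lparr>carrier := cocycles G M n\<rparr>"

definition cohomology_group ::
    "('a, 'b) monoid_scheme \<Rightarrow> ('m, 'c) monoid_scheme \<Rightarrow> nat \<Rightarrow> ('a list \<Rightarrow> 'm) set monoid" where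
  "cohomology_group G M n = cocycle_group G M n Mod coboundaries G M n"

text \<open>
  Restriction to a subgroup \<open>A\<close> sends the class of a cocycle \<open>f\<close> to the class of the restriction
  of \<open>f\<close> to tuples from \<open>A\<close>. A class is a coset \<open>c\<close> of cocycles, all of whose members have the
  same image, so the image is a singleton and \<open>the_elem\<close> picks its element.
\<close>

definition cohomology_restriction ::
    "('a, 'b) monoid_scheme \<Rightarrow> ('m, 'c) monoid_scheme \<Rightarrow> nat \<Rightarrow> 'a set
      \<Rightarrow> ('a list \<Rightarrow> 'm) set \<Rightarrow> ('a list \<Rightarrow> 'm) set" where
  "cohomology_restriction G M n A c =
     (let H = G\<lparr>carrier := A\<rparr> in
      the_elem
        ((\<lambda>f. coboundaries H M n #>\<^bsub>cocycle_group H M n\<^esub> restrict f (bar_basis H n)) ` c))"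


subsection \<open>The Bogomolov multiplier\<close>

definition rat_group :: "rat monoid" where
  "rat_group = \<lparr>carrier = UNIV, monoid.mult = (+), one = 0\<rparr>"

definition rat_mod_int_group :: "rat set monoid" where
  "rat_mod_int_group = rat_group Mod \<int>"

definition abelian_subgroups :: "('a, 'b) monoid_scheme \<Rightarrow> 'a set set" where
  "abelian_subgroups G = {A. subgroup A G \<and> comm_group (G\<lparr>carrier := A\<rparr>)}"

definition bogomolov_multiplier :: "('a, 'b) monoid_scheme \<Rightarrow> ('a list \<Rightarrow> rat set) set set" where
  "bogomolov_multiplier G =
     kernel (cohomology_group G rat_mod_int_group 2)
       (sum_group (abelian_subgroups G)
          (\<lambda>A. cohomology_group (G\<lparr>carrier := A\<rparr>) rat_mod_int_group 2))
       (\<lambda>c. \<lambda>A\<in>abelian_subgroups G. cohomology_restriction G rat_mod_int_group 2 A c)"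

end

theory Submission
  imports Defs "HOL-Algebra.Multiplicative_Group"
begin

text \<open>
  Let \<open>e\<close> be the exponent of \<open>G\<close> and suppose \<open>e z\<close> is not a boundary for some \<open>2\<close>-cycle \<open>z\<close>.
  As \<open>\<rat>/\<int>\<close> is divisible with torsion of every order, some homomorphism \<open>\<phi>\<close> from the \<open>2\<close>-chains to
  \<open>\<rat>/\<int>\<close> kills the boundaries but not \<open>e z\<close>; so \<open>\<phi>\<close> is a \<open>2\<close>-cocycle. On an abelian subgroup the
  commutator pairing \<open>\<phi>(a, b) - \<phi>(b, a)\<close> is bilinear, hence killed by \<open>e\<close>. There \<open>e \<phi>\<close> is therefore
  symmetric, so its central extension by the divisible group \<open>\<rat>/\<int>\<close> is abelian and splits: \<open>e \<phi>\<close>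
  restricts to a coboundary on every abelian subgroup. Since \<open>B\<^sub>0(G) = 0\<close>, \<open>e \<phi>\<close> is a coboundary on
  \<open>G\<close> and vanishes on the cycle \<open>z\<close>, contradicting \<open>\<phi>(e z) \<noteq> 0\<close>.
\<close>

subsection \<open>Divisible subgroups of commutative groups\<close>

text \<open>Used in two ways: to enlarge a maximal subgroup by one element, and to build the graph
  of a homomorphism prescribed on a subgroup and at one further element.\<close>

lemma (in comm_group) subgroup_adjoin:
  assumes H: "subgroup H G" and y: "y \<in> carrier G"
  shows "subgroup {h \<otimes> y [^] (k::int) | h k. h \<in> H} G" (is "subgroup ?T G")
proof (rule subgroupI)
  have sub: "h \<in> carrier G" if "h \<in> H" for h
    using subgroup.mem_carrier[OF H that] .
  show "?T \<subseteq> carrier G"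
    using sub y by auto
  show "?T \<noteq> {}"
    using subgroup.one_closed[OF H] by auto
  show "inv a \<in> ?T" if a: "a \<in> ?T" for a
  proof -
    obtain h k where hk: "h \<in> H" "a = h \<otimes> y [^] (k::int)" using a by auto
    have "inv a = inv h \<otimes> y [^] (- k)"
      using hk sub y by (simp add: inv_mult int_pow_neg)
    then show ?thesis using subgroup.m_inv_closed[OF H hk(1)] by blast
  qed
  show "a \<otimes> b \<in> ?T" if ab: "a \<in> ?T" "b \<in> ?T" for a b
  proof -
    obtain h k where hk: "h \<in> H" "a = h \<otimes> y [^] (k::int)" using ab by auto
    obtain h' k' where hk': "h' \<in> H" "b = h' \<otimes> y [^] (k'::int)" using ab by auto
    have "a \<otimes> b = (h \<otimes> h') \<otimes> y [^] (k + k')"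
      using hk hk' sub y by (simp add: int_pow_mult m_ac)
    then show ?thesis using subgroup.m_closed[OF H hk(1) hk'(1)] by blast
  qed
qed

lemma subset_adjoin:
  assumes "group G" and "subgroup H G"
  shows "H \<subseteq> {h \<otimes>\<^bsub>G\<^esub> y [^]\<^bsub>G\<^esub> (k::int) | h k. h \<in> H}"
proof
  interpret group G by fact
  fix h assume h: "h \<in> H"
  then have "h = h \<otimes>\<^bsub>G\<^esub> y [^]\<^bsub>G\<^esub> (0::int)"
    using subgroup.mem_carrier[OF assms(2)] by simp
  then show "h \<in> {h \<otimes>\<^bsub>G\<^esub> y [^]\<^bsub>G\<^esub> (k::int) | h k. h \<in> H}"
    using h by blast
qed

lemma (in comm_group) subgroup_set_mult:
  assumes "subgroup H G" and "subgroup N G"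
  shows "subgroup (H <#> N) G"
proof (rule subgroupI)
  note H = subgroup.mem_carrier[OF assms(1)] and N = subgroup.mem_carrier[OF assms(2)]
  show "H <#> N \<subseteq> carrier G"
    using H N by (auto simp: set_mult_def)
  show "H <#> N \<noteq> {}"
    using assms[THEN subgroup.one_closed] by (auto simp: set_mult_def)
  show "inv a \<in> H <#> N" if "a \<in> H <#> N" for a
  proof -
    obtain h n where hn: "h \<in> H" "n \<in> N" "a = h \<otimes> n"
      using \<open>a \<in> H <#> N\<close> by (auto simp: set_mult_def)
    then have "inv a = inv h \<otimes> inv n"
      using H N by (simp add: inv_mult)
    then show ?thesis
      using hn assms[THEN subgroup.m_inv_closed] by (auto simp: set_mult_def)
  qed
  show "a \<otimes> b \<in> H <#> N" if "a \<in> H <#> N" "b \<in> H <#> N" for a b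
  proof -
    obtain h n where hn: "h \<in> H" "n \<in> N" "a = h \<otimes> n"
      using \<open>a \<in> H <#> N\<close> by (auto simp: set_mult_def)
    obtain h' n' where hn': "h' \<in> H" "n' \<in> N" "b = h' \<otimes> n'"
      using \<open>b \<in> H <#> N\<close> by (auto simp: set_mult_def)
    with hn have "a \<otimes> b = (h \<otimes> h') \<otimes> (n \<otimes> n')"
      using H N by (simp add: m_ac)
    then show ?thesis
      using hn hn' assms[THEN subgroup.m_closed] by (simp add: set_mult_def) blast
  qed
qed

text \<open>The exponents \<open>k\<close> with \<open>y [^] k\<close> in \<open>H\<close> form a
  subgroup of the integers, so they are the multiples of some \<open>m\<close>. This
  \<open>m\<close> acts as the order of \<open>y\<close> modulo \<open>H\<close>; infinite order is
  \<open>m = 0\<close>, because \<open>0 dvd k\<close> means \<open>k = 0\<close>.\<close>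

lemma (in group) int_pow_in_subgroup_iff:
  assumes H: "subgroup H G" and y: "y \<in> carrier G"
  shows "\<exists>m::nat. \<forall>k::int. y [^] k \<in> H \<longleftrightarrow> int m dvd k"
proof (cases "\<exists>k::nat>0. y [^] k \<in> H")
  case False
  have "y [^] k \<in> H \<longleftrightarrow> int 0 dvd k" for k :: int
  proof
    assume k: "y [^] k \<in> H"
    then have "y [^] (- k) \<in> H"
      using y subgroup.m_inv_closed[OF H] by (simp add: int_pow_neg)
    with k have "y [^] \<bar>k\<bar> \<in> H"
      by (simp add: abs_if)
    then have "y [^] nat \<bar>k\<bar> \<in> H"
      by (simp flip: int_pow_int)
    then have "nat \<bar>k\<bar> = 0"
      using False by (metis gr0I)
    then show "int 0 dvd k"
      by simp
  qed (use subgroup.one_closed[OF H] in simp)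
  then show ?thesis by (intro exI[of _ 0]) simp
next
  case True
  define m where "m = (LEAST k::nat. k > 0 \<and> y [^] k \<in> H)"
  have m: "m > 0" "y [^] m \<in> H"
    using LeastI_ex[OF True] by (simp_all add: m_def)
  have least: "\<not> y [^] k \<in> H" if "0 < k" "k < m" for k :: nat
    using not_less_Least[of k "\<lambda>k. k > 0 \<and> y [^] k \<in> H"] that by (auto simp: m_def)
  have mult: "y [^] (int m * q) \<in> H" for q
    using subgroup_int_pow_closed[OF H m(2), of q] y by (simp add: int_pow_pow flip: int_pow_int)
  have "y [^] k \<in> H \<longleftrightarrow> int m dvd k" for k :: int
  proof
    assume k: "y [^] k \<in> H"
    \<comment> \<open>Division with remainder: the power with exponent \<open>k mod int m\<close> is
      in \<open>H\<close>, so the minimality of \<open>m\<close> forces the remainder to be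
      zero.\<close>
    have "y [^] (k mod int m) = y [^] k \<otimes> inv (y [^] (int m * (k div int m)))"
      using y by (simp add: minus_mult_div_eq_mod flip: int_pow_diff)
    also have "\<dots> \<in> H"
      using k mult H by (simp add: subgroup.m_closed subgroup.m_inv_closed)
    finally have "y [^] nat (k mod int m) \<in> H"
      using m(1) by (simp flip: int_pow_int)
    moreover have "nat (k mod int m) < m"
      using m(1) by (simp add: nat_less_iff)
    ultimately have "nat (k mod int m) = 0"
      using least by blast
    then show "int m dvd k"
      using m(1) by (simp add: dvd_eq_mod_eq_0) (smt (verit) pos_mod_sign of_nat_0_less_iff)
  qed (use mult in \<open>auto elim!: dvdE\<close>)
  then show ?thesis by (intro exI[of _ m]) simp
qed

text \<open>By Zorn, take \<open>H\<close> maximal among the subgroups above \<open>H0\<close> that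
  meet \<open>N\<close> only inside \<open>H0\<close>. Divisibility allows any \<open>y\<close> to
  be changed by an element of \<open>N\<close> so that adjoining the result to \<open>H\<close> adds
  nothing to the intersection with \<open>N\<close>. Maximality puts the changed element into
  \<open>H\<close>, hence \<open>y\<close> into \<open>H <#> N\<close>.\<close>

lemma (in comm_group) divisible_subgroup_complement:
  assumes N: "subgroup N G"
    and div: "\<And>x k::nat. x \<in> N \<Longrightarrow> k > 0 \<Longrightarrow> \<exists>y\<in>N. y [^] k = x"
    and H0: "subgroup H0 G"
  obtains H where "subgroup H G" "H0 \<subseteq> H" "H \<inter> N \<subseteq> H0" "H <#> N = carrier G"
proof -
  define S where "S = {H. subgroup H G \<and> H0 \<subseteq> H \<and> H \<inter> N \<subseteq> H0}"
  have "\<exists>H\<in>S. \<forall>X\<in>S. H \<subseteq> X \<longrightarrow> X = H"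
  proof (rule subset_Zorn_nonempty)
    show "S \<noteq> {}" using H0 by (auto simp: S_def)
    fix C assume ne: "C \<noteq> {}" and ch: "subset.chain S C"
    have CS: "\<And>H. H \<in> C \<Longrightarrow> subgroup H G \<and> H0 \<subseteq> H \<and> H \<inter> N \<subseteq> H0"
      using ch by (auto simp: subset_chain_def S_def)
    have "subgroup (\<Union>C) G"
    proof (rule subgroupI)
      show "\<Union>C \<subseteq> carrier G" using CS subgroup.subset by blast
      show "\<Union>C \<noteq> {}" using ne CS subgroup.one_closed by blast
      show "inv a \<in> \<Union>C" if "a \<in> \<Union>C" for a
        using that CS subgroup.m_inv_closed by (metis Union_iff)
      show "a \<otimes> b \<in> \<Union>C" if ab: "a \<in> \<Union>C" "b \<in> \<Union>C" for a b
      proof -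
        obtain X Y where XY: "X \<in> C" "a \<in> X" "Y \<in> C" "b \<in> Y" using ab by auto
        have "X \<subseteq> Y \<or> Y \<subseteq> X" using ch XY by (simp add: subset_chain_def)
        then obtain Z where "Z \<in> C" "a \<in> Z" "b \<in> Z" using XY by blast
        then show ?thesis using CS subgroup.m_closed by (metis Union_iff)
      qed
    qed
    then show "\<Union>C \<in> S" using ne CS by (auto simp: S_def)
  qed
  then obtain H where "H \<in> S" and maxS: "\<forall>X\<in>S. H \<subseteq> X \<longrightarrow> X = H"
    by blast
  then have H: "subgroup H G" "H0 \<subseteq> H" "H \<inter> N \<subseteq> H0"
    by (simp_all add: S_def)
  have max: "X = H" if "subgroup X G" "H \<subseteq> X" "X \<inter> N \<subseteq> H0" for X
    using maxS that H(2) by (simp add: S_def)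
  note HN = subgroup_set_mult[OF H(1) N]
  note Hc = subgroup.mem_carrier[OF H(1)] and Nc = subgroup.mem_carrier[OF N]
  have H_HN: "h \<in> H <#> N" if "h \<in> H" for h
    using that subgroup.one_closed[OF N] Hc[OF that] by (force simp: set_mult_def)
  have N_HN: "n \<in> H <#> N" if "n \<in> N" for n
    using that subgroup.one_closed[OF H(1)] Nc[OF that] by (force simp: set_mult_def)
  have "y \<in> H <#> N" if y: "y \<in> carrier G" for y
  proof -
    obtain m where m: "\<And>k::int. y [^] k \<in> H <#> N \<longleftrightarrow> int m dvd k"
      using int_pow_in_subgroup_iff[OF HN y] by blast
    \<comment> \<open>If \<open>y [^] m = h \<otimes> n\<close>, dividing \<open>y\<close> by an
      \<open>m\<close>-th root of \<open>n\<close> moves the \<open>m\<close>-th power into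
      \<open>H\<close>. If \<open>m = 0\<close>, the power is the identity and \<open>y\<close> can
      stay as it is.\<close>
    have "\<exists>n\<in>N. (y \<otimes> n) [^] m \<in> H"
    proof (cases "m = 0")
      case True
      then show ?thesis using subgroup.one_closed[OF H(1)] subgroup.one_closed[OF N] by auto
    next
      case False
      have "y [^] m \<in> H <#> N" using m[of "int m"] by (simp add: int_pow_int)
      then obtain h n where hn: "h \<in> H" "n \<in> N" "y [^] m = h \<otimes> n"
        by (auto simp: set_mult_def)
      obtain n' where n': "n' \<in> N" "n' [^] m = n" using div[OF hn(2)] False by auto
      have "(y \<otimes> inv n') [^] m = h \<otimes> n \<otimes> inv n"
        using y n' hn Nc by (simp add: pow_mult_distrib m_comm nat_pow_inv)
      then have "(y \<otimes> inv n') [^] m = h" using hn Hc Nc by (simp add: m_assoc)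
      then show ?thesis using hn n' subgroup.m_inv_closed[OF N] by auto
    qed
    then obtain n where n: "n \<in> N" "(y \<otimes> n) [^] m \<in> H" by auto
    define w where "w = y \<otimes> n"
    have wc: "w \<in> carrier G" using y n Nc by (simp add: w_def)
    have pw: "w [^] k \<in> H" if "int m dvd k" for k
      using that subgroup_int_pow_closed[OF H(1) n(2)] wc
      by (auto elim!: dvdE simp: int_pow_pow w_def[symmetric] simp flip: int_pow_int)
    let ?T = "{h \<otimes> w [^] (k::int) | h k. h \<in> H}"
    have "?T = H"
    proof (rule max)
      show "subgroup ?T G" using subgroup_adjoin[OF H(1) wc] .
      show "H \<subseteq> ?T" by (rule subset_adjoin[OF group_axioms H(1)])
      \<comment> \<open>If \<open>h \<otimes> w [^] k\<close> lies in \<open>N\<close>, then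
        \<open>y [^] k\<close> lies in \<open>H <#> N\<close>, so \<open>m\<close> divides
        \<open>k\<close> and \<open>w [^] k\<close> is already in \<open>H\<close>. The element is
        then in both \<open>H\<close> and \<open>N\<close>, hence in \<open>H0\<close>.\<close>
      show "?T \<inter> N \<subseteq> H0"
      proof
        fix t assume t: "t \<in> ?T \<inter> N"
        then obtain h k where hk: "h \<in> H" "t = h \<otimes> w [^] (k::int)" by auto
        have "y [^] k = inv h \<otimes> t \<otimes> inv (n [^] k)"
          using hk y n Hc Nc by (simp add: w_def int_pow_distrib m_assoc) (simp add: m_assoc[symmetric])
        moreover have "inv h \<in> H <#> N" "t \<in> H <#> N" "inv (n [^] k) \<in> H <#> N"
          using hk t n H_HN N_HN subgroup.m_inv_closed[OF H(1)] subgroup.m_inv_closed[OF N]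
            subgroup_int_pow_closed[OF N] by auto
        ultimately have "y [^] k \<in> H <#> N" using subgroup.m_closed[OF HN] by metis
        then have "int m dvd k" using m by blast
        then have "t \<in> H" using hk pw subgroup.m_closed[OF H(1)] by simp
        then show "t \<in> H0" using t H by auto
      qed
    qed
    moreover have "w \<in> ?T"
      using subgroup.one_closed[OF H(1)] wc
      by (intro CollectI exI[of _ \<one>] exI[of _ "1::int"]) auto
    ultimately have "w \<in> H" by simp
    then have "w \<otimes> inv n \<in> H <#> N" using n subgroup.m_inv_closed[OF N] by (auto simp: set_mult_def)
    then show ?thesis using y n Nc by (simp add: w_def m_assoc)
  qed
  then have "H <#> N = carrier G" using subgroup.subset[OF HN] by blast
  with H show ?thesis by (rule that)
qed

subsection \<open>Central extensions by divisible groups\<close>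

text \<open>Curried form of the condition behind \<open>cocycles A M 2\<close>, with the two faces
  of negative sign moved to the right-hand side. Unlike a bar cochain, \<open>f\<close> is arbitrary
  outside the carrier.\<close>

definition cocycle2 :: "('a, 'b) monoid_scheme \<Rightarrow> ('m, 'c) monoid_scheme \<Rightarrow> ('a \<Rightarrow> 'a \<Rightarrow> 'm) \<Rightarrow> bool" where
  "cocycle2 A M f \<longleftrightarrow>
     (\<forall>a\<in>carrier A. \<forall>b\<in>carrier A. f a b \<in> carrier M) \<and>
     (\<forall>a\<in>carrier A. \<forall>b\<in>carrier A. \<forall>c\<in>carrier A.
        f b c \<otimes>\<^bsub>M\<^esub> f a (b \<otimes>\<^bsub>A\<^esub> c) = f (a \<otimes>\<^bsub>A\<^esub> b) c \<otimes>\<^bsub>M\<^esub> f a b)"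

text \<open>Cocycles are not assumed to be normalized, so the identity has second component
  \<open>(f 1 1)\<^sup>-\<^sup>1\<close>.\<close>

definition central_extension ::
    "('a, 'b) monoid_scheme \<Rightarrow> ('m, 'c) monoid_scheme \<Rightarrow> ('a \<Rightarrow> 'a \<Rightarrow> 'm) \<Rightarrow> ('a \<times> 'm) monoid" where
  "central_extension A M f =
     \<lparr>carrier = carrier A \<times> carrier M,
      monoid.mult = (\<lambda>(a, p) (b, q). (a \<otimes>\<^bsub>A\<^esub> b, p \<otimes>\<^bsub>M\<^esub> q \<otimes>\<^bsub>M\<^esub> f a b)),
      one = (\<one>\<^bsub>A\<^esub>, inv\<^bsub>M\<^esub> f \<one>\<^bsub>A\<^esub> \<one>\<^bsub>A\<^esub>)\<rparr>"

lemma central_extension_simps: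
  "carrier (central_extension A M f) = carrier A \<times> carrier M"
  "(a, p) \<otimes>\<^bsub>central_extension A M f\<^esub> (b, q) = (a \<otimes>\<^bsub>A\<^esub> b, p \<otimes>\<^bsub>M\<^esub> q \<otimes>\<^bsub>M\<^esub> f a b)"
  "\<one>\<^bsub>central_extension A M f\<^esub> = (\<one>\<^bsub>A\<^esub>, inv\<^bsub>M\<^esub> f \<one>\<^bsub>A\<^esub> \<one>\<^bsub>A\<^esub>)"
  by (simp_all add: central_extension_def)

text \<open>Associativity amounts to the cocycle identity and commutativity to the symmetry of
  \<open>f\<close>.\<close>

lemma comm_group_central_extension:
  assumes "comm_group A" and "comm_group M" and "cocycle2 A M f"
    and sym: "\<And>a b. a \<in> carrier A \<Longrightarrow> b \<in> carrier A \<Longrightarrow> f a b = f b a"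
  shows "comm_group (central_extension A M f)"
proof -
  interpret A: comm_group A by fact
  interpret M: comm_group M by fact
  have [simp]: "f a b \<in> carrier M" if "a \<in> carrier A" "b \<in> carrier A" for a b
    using assms(3) that by (simp add: cocycle2_def)
  have coc: "f b c \<otimes>\<^bsub>M\<^esub> f a (b \<otimes>\<^bsub>A\<^esub> c) = f (a \<otimes>\<^bsub>A\<^esub> b) c \<otimes>\<^bsub>M\<^esub> f a b"
    if "a \<in> carrier A" "b \<in> carrier A" "c \<in> carrier A" for a b c
    using assms(3) that by (simp add: cocycle2_def)
  \<comment> \<open>The cocycle identity at \<open>(1, 1, a)\<close>, after cancelling
    \<open>f 1 a\<close>. Hence one correction by the inverse of \<open>f 1 1\<close> makes a left
    identity for all elements at once.\<close>
  have one: "f \<one>\<^bsub>A\<^esub> a = f \<one>\<^bsub>A\<^esub> \<one>\<^bsub>A\<^esub>" if "a \<in> carrier A" for a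
    using coc[of "\<one>\<^bsub>A\<^esub>" "\<one>\<^bsub>A\<^esub>" a] that by simp
  let ?E = "central_extension A M f"
  show ?thesis
  proof (rule comm_groupI)
    fix x y z assume xyz: "x \<in> carrier ?E" "y \<in> carrier ?E" "z \<in> carrier ?E"
    obtain a p b q c r where [simp]: "x = (a, p)" "y = (b, q)" "z = (c, r)"
      by (metis prod.exhaust)
    have [simp]: "a \<in> carrier A" "b \<in> carrier A" "c \<in> carrier A"
      "p \<in> carrier M" "q \<in> carrier M" "r \<in> carrier M"
      using xyz by (simp_all add: central_extension_simps)
    have "p \<otimes>\<^bsub>M\<^esub> q \<otimes>\<^bsub>M\<^esub> f a b \<otimes>\<^bsub>M\<^esub> r \<otimes>\<^bsub>M\<^esub> f (a \<otimes>\<^bsub>A\<^esub> b) c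
        = p \<otimes>\<^bsub>M\<^esub> q \<otimes>\<^bsub>M\<^esub> r \<otimes>\<^bsub>M\<^esub> (f (a \<otimes>\<^bsub>A\<^esub> b) c \<otimes>\<^bsub>M\<^esub> f a b)"
      by (simp add: M.m_ac)
    also have "\<dots> = p \<otimes>\<^bsub>M\<^esub> (q \<otimes>\<^bsub>M\<^esub> r \<otimes>\<^bsub>M\<^esub> f b c) \<otimes>\<^bsub>M\<^esub> f a (b \<otimes>\<^bsub>A\<^esub> c)"
      using coc[of a b c] by (simp add: M.m_assoc)
    finally show "x \<otimes>\<^bsub>?E\<^esub> y \<otimes>\<^bsub>?E\<^esub> z = x \<otimes>\<^bsub>?E\<^esub> (y \<otimes>\<^bsub>?E\<^esub> z)"
      by (simp add: central_extension_simps A.m_assoc)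
  next
    fix x assume x: "x \<in> carrier ?E"
    then obtain a p where [simp]: "x = (a, p)" and [simp]: "a \<in> carrier A" "p \<in> carrier M"
      by (auto simp: central_extension_simps)
    have "inv\<^bsub>M\<^esub> f \<one>\<^bsub>A\<^esub> \<one>\<^bsub>A\<^esub> \<otimes>\<^bsub>M\<^esub> p \<otimes>\<^bsub>M\<^esub> f \<one>\<^bsub>A\<^esub> \<one>\<^bsub>A\<^esub> = p"
      by (simp add: M.m_comm[of _ p] M.m_assoc)
    then show "\<one>\<^bsub>?E\<^esub> \<otimes>\<^bsub>?E\<^esub> x = x"
      by (simp add: central_extension_simps one[of a])
    \<comment> \<open>The second component of the left inverse of \<open>(a, p)\<close> must cancel
      both \<open>p\<close> and \<open>f (inv a) a\<close> and leave \<open>?u\<close>, the second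
      component of the identity.\<close>
    let ?u = "inv\<^bsub>M\<^esub> f \<one>\<^bsub>A\<^esub> \<one>\<^bsub>A\<^esub>" and ?v = "p \<otimes>\<^bsub>M\<^esub> f (inv\<^bsub>A\<^esub> a) a"
    have "?u \<otimes>\<^bsub>M\<^esub> inv\<^bsub>M\<^esub> ?v \<otimes>\<^bsub>M\<^esub> p \<otimes>\<^bsub>M\<^esub> f (inv\<^bsub>A\<^esub> a) a = ?u \<otimes>\<^bsub>M\<^esub> (inv\<^bsub>M\<^esub> ?v \<otimes>\<^bsub>M\<^esub> ?v)"
      by (simp add: M.m_assoc del: M.l_inv)
    also have "\<dots> = ?u"
      by simp
    finally have "(inv\<^bsub>A\<^esub> a, ?u \<otimes>\<^bsub>M\<^esub> inv\<^bsub>M\<^esub> ?v) \<otimes>\<^bsub>?E\<^esub> x = \<one>\<^bsub>?E\<^esub>"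
      by (simp add: central_extension_simps)
    then show "\<exists>y\<in>carrier ?E. y \<otimes>\<^bsub>?E\<^esub> x = \<one>\<^bsub>?E\<^esub>"
      by (rule bexI) (simp add: central_extension_simps)
  qed (auto simp: central_extension_simps sym M.m_comm A.m_comm)
qed

text \<open>A divisible kernel has a complement containing any subgroup that meets it trivially, and the
  complement is the graph of the required function.\<close>

lemma symmetric_cocycle_splits:
  assumes A: "comm_group A" and M: "comm_group M" and coc: "cocycle2 A M f"
    and sym: "\<And>a b. a \<in> carrier A \<Longrightarrow> b \<in> carrier A \<Longrightarrow> f a b = f b a"
    and div: "\<And>x k::nat. x \<in> carrier M \<Longrightarrow> k > 0 \<Longrightarrow> \<exists>y\<in>carrier M. y [^]\<^bsub>M\<^esub> k = x"
    and H0: "subgroup H0 (central_extension A M f)"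
    and triv: "\<And>m. (\<one>\<^bsub>A\<^esub>, m) \<in> H0 \<Longrightarrow> (\<one>\<^bsub>A\<^esub>, m) = \<one>\<^bsub>central_extension A M f\<^esub>"
  shows "\<exists>h\<in>carrier A \<rightarrow> carrier M.
    (\<forall>a\<in>carrier A. \<forall>b\<in>carrier A. h (a \<otimes>\<^bsub>A\<^esub> b) = h a \<otimes>\<^bsub>M\<^esub> h b \<otimes>\<^bsub>M\<^esub> f a b) \<and>
    (\<forall>(a, m)\<in>H0. h a = m)"
proof -
  interpret A: comm_group A by fact
  interpret M: comm_group M by fact
  let ?E = "central_extension A M f"
  interpret E: comm_group ?E
    using comm_group_central_extension[OF A M coc sym] .
  have fc [simp]: "f a b \<in> carrier M" if "a \<in> carrier A" "b \<in> carrier A" for a b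
    using coc that by (simp add: cocycle2_def)
  let ?N = "{\<one>\<^bsub>A\<^esub>} \<times> carrier M"
  let ?g = "f \<one>\<^bsub>A\<^esub> \<one>\<^bsub>A\<^esub>"
  have fst_hom: "fst \<in> hom ?E A"
    by (auto simp: hom_def central_extension_simps)
  have N_kernel: "?N = kernel ?E A fst"
    by (auto simp: kernel_def central_extension_simps)
  have N: "subgroup ?N ?E"
    unfolding N_kernel
    by (intro group_hom.subgroup_kernel group_hom.intro group_hom_axioms.intro
        fst_hom E.group_axioms A.group_axioms)
  \<comment> \<open>In the fibre over \<open>1\<close> the product is
    \<open>(1, p) (1, q) = (1, p q ?g)\<close>, so multiplying the second component by
    \<open>?g\<close> is an isomorphism onto \<open>M\<close>. Powers and roots are taken in
    \<open>M\<close> after this shift.\<close>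
  have pow: "(\<one>\<^bsub>A\<^esub>, q) [^]\<^bsub>?E\<^esub> k = (\<one>\<^bsub>A\<^esub>, inv\<^bsub>M\<^esub> ?g \<otimes>\<^bsub>M\<^esub> (q \<otimes>\<^bsub>M\<^esub> ?g) [^]\<^bsub>M\<^esub> k)"
    if "q \<in> carrier M" for q and k :: nat
    by (induction k) (use that in \<open>simp_all add: central_extension_simps M.m_assoc\<close>)
  have "\<exists>y\<in>?N. y [^]\<^bsub>?E\<^esub> k = x" if x: "x \<in> ?N" and k: "k > 0" for x and k :: nat
  proof -
    obtain q where q: "x = (\<one>\<^bsub>A\<^esub>, q)" "q \<in> carrier M" using x by auto
    obtain y where y: "y \<in> carrier M" "y [^]\<^bsub>M\<^esub> k = q \<otimes>\<^bsub>M\<^esub> ?g"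
      using div[of "q \<otimes>\<^bsub>M\<^esub> ?g" k] q k by auto
    have "(\<one>\<^bsub>A\<^esub>, y \<otimes>\<^bsub>M\<^esub> inv\<^bsub>M\<^esub> ?g) [^]\<^bsub>?E\<^esub> k = x"
      using y q by (simp add: pow M.m_assoc) (simp add: M.m_lcomm)
    then show ?thesis by (rule bexI) (use y in simp)
  qed
  from E.divisible_subgroup_complement[OF N this H0]
  obtain H where H: "subgroup H ?E" "H0 \<subseteq> H" "H \<inter> ?N \<subseteq> H0" "H <#>\<^bsub>?E\<^esub> ?N = carrier ?E" .
  note Hc = subgroup.mem_carrier[OF H(1)]
  \<comment> \<open>\<open>H\<close> meets every fibre of the projection, since multiplying it by
    the fibre over \<open>1\<close> gives the whole extension.\<close>
  have ex: "\<exists>m. (a, m) \<in> H" if "a \<in> carrier A" for a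
  proof -
    have "(a, \<one>\<^bsub>M\<^esub>) \<in> H <#>\<^bsub>?E\<^esub> ?N" using that H(4) by (simp add: central_extension_simps)
    then obtain b m q where bm: "(b, m) \<in> H" "q \<in> carrier M"
      "(a, \<one>\<^bsub>M\<^esub>) = (b, m) \<otimes>\<^bsub>?E\<^esub> (\<one>\<^bsub>A\<^esub>, q)"
      by (auto simp: set_mult_def)
    then have "a = b" using Hc[OF bm(1)] by (simp add: central_extension_simps)
    then show ?thesis using bm by auto
  qed
  \<comment> \<open>Two points of \<open>H\<close> in the same fibre differ by an element of
    \<open>H\<close> over \<open>1\<close>. That element lies in \<open>H0\<close>, and
    \<open>triv\<close> makes it the identity.\<close>
  have uniq: "m = m'" if m: "(a, m) \<in> H" "(a, m') \<in> H" for a m m'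
  proof -
    have "(a, m) \<otimes>\<^bsub>?E\<^esub> inv\<^bsub>?E\<^esub> (a, m') \<in> H" (is "?d \<in> H")
      using m H(1) by (simp add: subgroup.m_closed subgroup.m_inv_closed)
    moreover have c: "(a, m) \<in> carrier ?E" "(a, m') \<in> carrier ?E"
      using m Hc by auto
    moreover have "fst ?d = \<one>\<^bsub>A\<^esub>"
      using c fst_hom E.inv_closed[OF c(2)] 
      by (simp add: hom_mult[OF fst_hom] group_hom.hom_inv[of ?E A fst] group_hom_def
          group_hom_axioms_def E.group_axioms A.group_axioms)
        (simp add: central_extension_simps)
    ultimately have "?d \<in> H0" using H(3) Hc
      by (cases ?d) (auto simp: central_extension_simps)
    then have "?d = \<one>\<^bsub>?E\<^esub>"
      using triv[of "snd ?d"] \<open>fst ?d = _\<close> by (metis prod.collapse)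
    then have "(a, m) = (a, m')" using c E.inv_equality E.inv_inv E.inv_closed by metis
    then show ?thesis by simp
  qed
  define h where "h a = (SOME m. (a, m) \<in> H)" for a
  have hH: "(a, h a) \<in> H" if "a \<in> carrier A" for a
    using someI_ex[OF ex[OF that]] by (simp add: h_def)
  have h_eq: "h a = m" if "(a, m) \<in> H" for a m
    using uniq[OF hH that] Hc[OF that] by (simp add: central_extension_simps)
  show ?thesis
  proof (intro bexI[of _ h] conjI ballI)
    show "h \<in> carrier A \<rightarrow> carrier M"
      using Hc[OF hH] by (auto simp: central_extension_simps)
    \<comment> \<open>The product of the graph points over \<open>a\<close> and \<open>b\<close> is
      again in \<open>H\<close>, and reading off its second component gives the equation.\<close>
    show "h (a \<otimes>\<^bsub>A\<^esub> b) = h a \<otimes>\<^bsub>M\<^esub> h b \<otimes>\<^bsub>M\<^esub> f a b"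
      if "a \<in> carrier A" "b \<in> carrier A" for a b
      using subgroup.m_closed[OF H(1) hH[OF that(1)] hH[OF that(2)]]
      by (intro h_eq) (simp add: central_extension_simps)
    show "case x of (a, m) \<Rightarrow> h a = m" if "x \<in> H0" for x
      using that H(2) h_eq by auto
  qed
qed

text \<open>The value is the commutator of lifts of \<open>a\<close> and \<open>x\<close> in the
  central extension; commutators there are central, which makes the pairing bilinear. Linearity in
  one slot is derived here from the cocycle identity alone.\<close>

lemma cocycle_commutator_hom:
  assumes A: "comm_group A" and M: "comm_group M" and coc: "cocycle2 A M f"
    and x: "x \<in> carrier A"
  shows "(\<lambda>a. f a x \<otimes>\<^bsub>M\<^esub> inv\<^bsub>M\<^esub> f x a) \<in> hom A M"
proof (rule homI)
  interpret A: comm_group A by fact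
  interpret M: comm_group M by fact
  have [simp]: "f a b \<in> carrier M" if "a \<in> carrier A" "b \<in> carrier A" for a b
    using coc that by (simp add: cocycle2_def)
  have coc: "f b c \<otimes>\<^bsub>M\<^esub> f a (b \<otimes>\<^bsub>A\<^esub> c) = f (a \<otimes>\<^bsub>A\<^esub> b) c \<otimes>\<^bsub>M\<^esub> f a b"
    if "a \<in> carrier A" "b \<in> carrier A" "c \<in> carrier A" for a b c
    using coc that by (simp add: cocycle2_def)
  fix a b assume ab [simp]: "a \<in> carrier A" "b \<in> carrier A"
  note x [simp]
  show "f a x \<otimes>\<^bsub>M\<^esub> inv\<^bsub>M\<^esub> f x a \<in> carrier M" by simp
  \<comment> \<open>\<open>?K\<close> collects the factors shared by both sides when the cocycle
    identities at \<open>(a, b, x)\<close>, \<open>(x, a, b)\<close> and, reversed,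
    \<open>(a, x, b)\<close> are multiplied. Commutativity of \<open>A\<close> matches
    \<open>a x\<close> with \<open>x a\<close> and \<open>b x\<close> with
    \<open>x b\<close>.\<close>
  let ?K = "f a b \<otimes>\<^bsub>M\<^esub> f a (b \<otimes>\<^bsub>A\<^esub> x) \<otimes>\<^bsub>M\<^esub> f (a \<otimes>\<^bsub>A\<^esub> x) b"
  have "?K \<otimes>\<^bsub>M\<^esub> (f (a \<otimes>\<^bsub>A\<^esub> b) x \<otimes>\<^bsub>M\<^esub> f x a \<otimes>\<^bsub>M\<^esub> f x b)
      = (f (a \<otimes>\<^bsub>A\<^esub> b) x \<otimes>\<^bsub>M\<^esub> f a b) \<otimes>\<^bsub>M\<^esub> (f (x \<otimes>\<^bsub>A\<^esub> a) b \<otimes>\<^bsub>M\<^esub> f x a) \<otimes>\<^bsub>M\<^esub> (f x b \<otimes>\<^bsub>M\<^esub> f a (x \<otimes>\<^bsub>A\<^esub> b))"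
    by (simp add: M.m_ac A.m_comm)
  also have "\<dots> = (f b x \<otimes>\<^bsub>M\<^esub> f a (b \<otimes>\<^bsub>A\<^esub> x)) \<otimes>\<^bsub>M\<^esub> (f a b \<otimes>\<^bsub>M\<^esub> f x (a \<otimes>\<^bsub>A\<^esub> b)) \<otimes>\<^bsub>M\<^esub> (f (a \<otimes>\<^bsub>A\<^esub> x) b \<otimes>\<^bsub>M\<^esub> f a x)"
    by (simp only: coc[OF ab x] coc[OF x ab] coc[OF ab(1) x ab(2)])
  also have "\<dots> = ?K \<otimes>\<^bsub>M\<^esub> (f x (a \<otimes>\<^bsub>A\<^esub> b) \<otimes>\<^bsub>M\<^esub> f a x \<otimes>\<^bsub>M\<^esub> f b x)"
    by (simp add: M.m_ac)
  finally have eq: "f (a \<otimes>\<^bsub>A\<^esub> b) x \<otimes>\<^bsub>M\<^esub> (f x a \<otimes>\<^bsub>M\<^esub> f x b) = f x (a \<otimes>\<^bsub>A\<^esub> b) \<otimes>\<^bsub>M\<^esub> (f a x \<otimes>\<^bsub>M\<^esub> f b x)"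
    by (simp add: M.m_assoc)
  have quot: "p \<otimes>\<^bsub>M\<^esub> inv\<^bsub>M\<^esub> q = r \<otimes>\<^bsub>M\<^esub> inv\<^bsub>M\<^esub> s"
    if "p \<otimes>\<^bsub>M\<^esub> s = q \<otimes>\<^bsub>M\<^esub> r" and c: "p \<in> carrier M" "q \<in> carrier M" "r \<in> carrier M" "s \<in> carrier M" for p q r s
  proof -
    have "p \<otimes>\<^bsub>M\<^esub> inv\<^bsub>M\<^esub> q = (p \<otimes>\<^bsub>M\<^esub> s) \<otimes>\<^bsub>M\<^esub> (inv\<^bsub>M\<^esub> q \<otimes>\<^bsub>M\<^esub> inv\<^bsub>M\<^esub> s)"
      using c by (simp add: M.m_ac)
    also have "\<dots> = (q \<otimes>\<^bsub>M\<^esub> inv\<^bsub>M\<^esub> q) \<otimes>\<^bsub>M\<^esub> (r \<otimes>\<^bsub>M\<^esub> inv\<^bsub>M\<^esub> s)"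
      using c by (simp only: that(1) M.m_ac M.m_closed M.inv_closed)
    also have "\<dots> = r \<otimes>\<^bsub>M\<^esub> inv\<^bsub>M\<^esub> s"
      using c by simp
    finally show ?thesis .
  qed
  show "f (a \<otimes>\<^bsub>A\<^esub> b) x \<otimes>\<^bsub>M\<^esub> inv\<^bsub>M\<^esub> f x (a \<otimes>\<^bsub>A\<^esub> b)
      = f a x \<otimes>\<^bsub>M\<^esub> inv\<^bsub>M\<^esub> f x a \<otimes>\<^bsub>M\<^esub> (f b x \<otimes>\<^bsub>M\<^esub> inv\<^bsub>M\<^esub> f x b)"
    using quot[OF eq] by (simp add: M.inv_mult M.m_ac)
qed

text \<open>The commutator pairing is a homomorphism in \<open>a\<close>, so \<open>a^e = 1\<close>
  kills its \<open>e\<close>-th power. Thus the \<open>e\<close>-th power of \<open>f\<close> is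
  symmetric and splits over the divisible group \<open>M\<close>.\<close>

lemma cocycle_power_is_coboundary:
  assumes A: "comm_group A" and M: "comm_group M" and coc: "cocycle2 A M f"
    and div: "\<And>x k::nat. x \<in> carrier M \<Longrightarrow> k > 0 \<Longrightarrow> \<exists>y\<in>carrier M. y [^]\<^bsub>M\<^esub> k = x"
    and exp: "\<And>a. a \<in> carrier A \<Longrightarrow> a [^]\<^bsub>A\<^esub> (e::nat) = \<one>\<^bsub>A\<^esub>"
  shows "\<exists>h\<in>carrier A \<rightarrow> carrier M. \<forall>a\<in>carrier A. \<forall>b\<in>carrier A.
    f a b [^]\<^bsub>M\<^esub> e = h b \<otimes>\<^bsub>M\<^esub> inv\<^bsub>M\<^esub> h (a \<otimes>\<^bsub>A\<^esub> b) \<otimes>\<^bsub>M\<^esub> h a"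
proof -
  interpret A: comm_group A by fact
  interpret M: comm_group M by fact
  have fc [simp]: "f a b \<in> carrier M" if "a \<in> carrier A" "b \<in> carrier A" for a b
    using coc that by (simp add: cocycle2_def)
  let ?g = "\<lambda>a b. f a b [^]\<^bsub>M\<^esub> e"
  have coc': "cocycle2 A M ?g"
    using coc by (simp add: cocycle2_def flip: M.nat_pow_distrib)
  have sym: "?g a x = ?g x a" if a: "a \<in> carrier A" and x: "x \<in> carrier A" for a x
  proof -
    let ?c = "\<lambda>a. f a x \<otimes>\<^bsub>M\<^esub> inv\<^bsub>M\<^esub> f x a"
    interpret c: group_hom A M ?c
      using cocycle_commutator_hom[OF A M coc x]
      by (simp add: group_hom_def group_hom_axioms_def A.group_axioms M.group_axioms)
    have "?c a [^]\<^bsub>M\<^esub> e = ?c (a [^]\<^bsub>A\<^esub> e)"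
      using c.hom_nat_pow[OF a] by simp
    also have "\<dots> = \<one>\<^bsub>M\<^esub>"
      using c.hom_one by (simp only: exp[OF a])
    finally have "?g a x \<otimes>\<^bsub>M\<^esub> inv\<^bsub>M\<^esub> ?g x a = \<one>\<^bsub>M\<^esub>"
      using a x by (simp add: M.nat_pow_distrib M.nat_pow_inv)
    then show ?thesis
      using a x M.inv_equality[of "?g a x" "inv\<^bsub>M\<^esub> ?g x a"] by simp
  qed
  interpret E: comm_group "central_extension A M ?g"
    using comm_group_central_extension[OF A M coc' sym] .
  \<comment> \<open>The prescribed part \<open>H0\<close> is the trivial subgroup, so any splitting
    will do.\<close>
  obtain h where h: "h \<in> carrier A \<rightarrow> carrier M"
    and heq: "\<And>a b. a \<in> carrier A \<Longrightarrow> b \<in> carrier A \<Longrightarrow> h (a \<otimes>\<^bsub>A\<^esub> b) = h a \<otimes>\<^bsub>M\<^esub> h b \<otimes>\<^bsub>M\<^esub> ?g a b"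
    using symmetric_cocycle_splits[OF A M coc' sym div E.triv_subgroup singletonD] by blast
  have [simp]: "h a \<in> carrier M" if "a \<in> carrier A" for a using h that by auto
  show ?thesis
  \<comment> \<open>A splitting satisfies \<open>h (a b) = h a h b ?g a b\<close>, which exhibits
    \<open>?g\<close> as the inverse of the coboundary of \<open>h\<close>; hence the pointwise
    inverse as witness.\<close>
  proof (intro bexI[of _ "\<lambda>a. inv\<^bsub>M\<^esub> h a"] ballI)
    show "(\<lambda>a. inv\<^bsub>M\<^esub> h a) \<in> carrier A \<rightarrow> carrier M" by auto
    show "?g a b = inv\<^bsub>M\<^esub> h b \<otimes>\<^bsub>M\<^esub> inv\<^bsub>M\<^esub> (inv\<^bsub>M\<^esub> h (a \<otimes>\<^bsub>A\<^esub> b)) \<otimes>\<^bsub>M\<^esub> inv\<^bsub>M\<^esub> h a"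
      if [simp]: "a \<in> carrier A" "b \<in> carrier A" for a b
    proof -
      have "?g a b = inv\<^bsub>M\<^esub> (h a \<otimes>\<^bsub>M\<^esub> h b) \<otimes>\<^bsub>M\<^esub> h (a \<otimes>\<^bsub>A\<^esub> b)"
        by (simp add: M.inv_solve_left heq)
      then show ?thesis by (simp add: M.inv_mult M.m_ac)
    qed
  qed
qed

subsection \<open>The group of rationals modulo integers\<close>

lemma comm_group_rat_group: "comm_group rat_group"
  by (rule comm_groupI) (auto simp: rat_group_def intro: exI[of _ "- _"] add_eq_0_iff)

lemma subgroup_Ints_rat_group: "subgroup \<int> rat_group"
proof (rule group.subgroupI)
  show "group rat_group"
    using comm_group_rat_group by (rule comm_group.axioms)
  show "inv\<^bsub>rat_group\<^esub> a \<in> \<int>" if "a \<in> \<int>" for a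
  proof -
    have "inv\<^bsub>rat_group\<^esub> a = - a"
      using \<open>group rat_group\<close> by (rule group.inv_equality) (simp_all add: rat_group_def)
    then show ?thesis using that by simp
  qed
qed (auto simp: rat_group_def)

lemma comm_group_rat_mod_int: "comm_group rat_mod_int_group"
  unfolding rat_mod_int_group_def
  using comm_group.abelian_FactGroup[OF comm_group_rat_group subgroup_Ints_rat_group] .

lemma carrier_rat_mod_int: "carrier rat_mod_int_group = range (\<lambda>q. \<int> #>\<^bsub>rat_group\<^esub> q)"
  by (auto simp: rat_mod_int_group_def FactGroup_def RCOSETS_def rat_group_def)

lemma rat_mod_int_pow:
  "(\<int> #>\<^bsub>rat_group\<^esub> q) [^]\<^bsub>rat_mod_int_group\<^esub> (k::int) = \<int> #>\<^bsub>rat_group\<^esub> (of_int k * q)"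
proof -
  interpret R: comm_group rat_group by (rule comm_group_rat_group)
  interpret Z: normal \<int> rat_group
    using R.subgroup_imp_normal[OF subgroup_Ints_rat_group] .
  have hom: "(\<lambda>q. \<int> #>\<^bsub>rat_group\<^esub> q) \<in> hom rat_group rat_mod_int_group"
    unfolding rat_mod_int_group_def by (rule Z.r_coset_hom_Mod)
  have c: "q \<in> carrier rat_group" for q by (simp add: rat_group_def)
  have nat: "q [^]\<^bsub>rat_group\<^esub> n = of_nat n * q" for n :: nat
  proof (induction n)
    case (Suc n)
    then show ?case by (simp add: algebra_simps) (simp add: rat_group_def)
  qed (simp add: rat_group_def)
  have inv: "inv\<^bsub>rat_group\<^esub> a = - a" for a
    by (rule R.inv_equality) (simp_all add: rat_group_def)
  have "q [^]\<^bsub>rat_group\<^esub> k = of_int k * q"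
    by (cases k rule: int_cases2) (simp_all add: R.int_pow_neg c nat inv int_pow_int)
  then show ?thesis
    using hom_int_pow[OF hom c R.group_axioms comm_group.axioms(2)[OF comm_group_rat_mod_int]]
    by metis
qed

lemma rat_mod_int_coset_eq_one_iff:
  "\<int> #>\<^bsub>rat_group\<^esub> q = \<one>\<^bsub>rat_mod_int_group\<^esub> \<longleftrightarrow> q \<in> \<int>"
proof -
  interpret R: comm_group rat_group by (rule comm_group_rat_group)
  have "\<one>\<^bsub>rat_mod_int_group\<^esub> = \<int>"
    by (simp add: rat_mod_int_group_def FactGroup_def)
  moreover have "q \<in> carrier rat_group" by (simp add: rat_group_def)
  ultimately show ?thesis
    using R.coset_join1[OF _ _ subgroup_Ints_rat_group] R.coset_join2[OF _ subgroup_Ints_rat_group]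
    by metis
qed

lemma rat_mod_int_divisible:
  assumes "x \<in> carrier rat_mod_int_group" and "k > (0::nat)"
  shows "\<exists>y\<in>carrier rat_mod_int_group. y [^]\<^bsub>rat_mod_int_group\<^esub> k = x"
proof -
  obtain q where q: "x = \<int> #>\<^bsub>rat_group\<^esub> q"
    using assms(1) by (auto simp: carrier_rat_mod_int)
  have "(\<int> #>\<^bsub>rat_group\<^esub> (q / of_nat k)) [^]\<^bsub>rat_mod_int_group\<^esub> k = x"
    using rat_mod_int_pow[of "q / of_nat k" "int k"] assms(2) q by (simp add: int_pow_int)
  then show ?thesis by (rule bexI) (simp add: carrier_rat_mod_int)
qed

text \<open>Provides the value that a homomorphism may take at an element of order \<open>m\<close>
  modulo a subgroup on which it is trivial.\<close>

lemma rat_mod_int_torsion: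
  assumes "m \<noteq> (1::nat)"
  shows "\<exists>r\<in>carrier rat_mod_int_group. r \<noteq> \<one>\<^bsub>rat_mod_int_group\<^esub> \<and>
    (\<forall>k::int. int m dvd k \<longrightarrow> r [^]\<^bsub>rat_mod_int_group\<^esub> k = \<one>\<^bsub>rat_mod_int_group\<^esub>)"
proof -
  \<comment> \<open>For \<open>m > 0\<close> the class of \<open>1/m\<close> works. For
    \<open>m = 0\<close> the only multiple is \<open>k = 0\<close>, so any nontrivial class works
    and \<open>1/2\<close> is taken.\<close>
  define d where "d = (if m = 0 then 2 else m)"
  have d: "d > 1" using assms by (auto simp: d_def)
  let ?r = "\<int> #>\<^bsub>rat_group\<^esub> (1 / of_nat d)"
  have "1 / rat_of_nat d \<notin> \<int>"
  proof
    assume "1 / rat_of_nat d \<in> \<int>"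
    then obtain z where "1 / rat_of_nat d = of_int z" by (auto elim: Ints_cases)
    then have "rat_of_int (z * int d) = of_int 1" using d by (simp add: field_simps)
    then have "z * int d = 1" by (simp only: of_int_eq_iff)
    then show False using d by (auto simp: zmult_eq_1_iff)
  qed
  moreover have "of_int k * (1 / rat_of_nat d) \<in> \<int>" if "int m dvd k" for k
    using that d by (cases "m = 0") (auto simp: d_def elim!: dvdE)
  ultimately show ?thesis
    by (intro bexI[of _ ?r])
      (simp_all add: rat_mod_int_pow rat_mod_int_coset_eq_one_iff carrier_rat_mod_int)
qed

text \<open>The map sending \<open>B\<close> to \<open>1\<close> and \<open>x\<close> to a
  nontrivial \<open>r\<close> is well defined on the subgroup generated by \<open>B\<close> and
  \<open>x\<close> once the order of \<open>x\<close> modulo \<open>B\<close> kills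
  \<open>r\<close>. It extends to \<open>C\<close> because the target is divisible: the splitting
  lemma for the trivial cocycle is exactly this extension statement, with \<open>H0\<close> the
  graph of the partial homomorphism.\<close>

lemma rat_mod_int_hom_separates:
  assumes C: "comm_group C" and B: "subgroup B C" and x: "x \<in> carrier C" "x \<notin> B"
  shows "\<exists>\<phi>\<in>hom C rat_mod_int_group. (\<forall>b\<in>B. \<phi> b = \<one>\<^bsub>rat_mod_int_group\<^esub>) \<and> \<phi> x \<noteq> \<one>\<^bsub>rat_mod_int_group\<^esub>"
proof -
  let ?M = rat_mod_int_group
  interpret C: comm_group C by fact
  interpret M: comm_group ?M by (rule comm_group_rat_mod_int)
  \<comment> \<open>With the constant cocycle the extension is the direct product, and a splitting
    function is a homomorphism.\<close>
  let ?f = "\<lambda>a b. \<one>\<^bsub>?M\<^esub>"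
  let ?E = "central_extension C ?M ?f"
  have coc: "cocycle2 C ?M ?f" by (simp add: cocycle2_def)
  interpret E: comm_group ?E
    using comm_group_central_extension[OF C M.comm_group_axioms coc] by simp
  obtain m where m: "\<And>k::int. x [^]\<^bsub>C\<^esub> k \<in> B \<longleftrightarrow> int m dvd k"
    using C.int_pow_in_subgroup_iff[OF B x(1)] by blast
  have "m \<noteq> 1" using m[of 1] x by auto
  then obtain r where r: "r \<in> carrier ?M" "r \<noteq> \<one>\<^bsub>?M\<^esub>"
    "\<And>k::int. int m dvd k \<Longrightarrow> r [^]\<^bsub>?M\<^esub> k = \<one>\<^bsub>?M\<^esub>"
    using rat_mod_int_torsion by blast
  note Bc = subgroup.mem_carrier[OF B]
  have inv: "inv\<^bsub>?E\<^esub> (b, \<one>\<^bsub>?M\<^esub>) = (inv\<^bsub>C\<^esub> b, \<one>\<^bsub>?M\<^esub>)" if "b \<in> carrier C" for b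
    by (rule E.inv_equality) (use that in \<open>simp_all add: central_extension_simps\<close>)
  have "subgroup (B \<times> {\<one>\<^bsub>?M\<^esub>}) ?E"
    by (rule E.subgroupI)
      (use subgroup.one_closed[OF B] subgroup.m_closed[OF B] subgroup.m_inv_closed[OF B] Bc
        in \<open>auto simp: central_extension_simps inv\<close>)
  moreover have xr: "(x, r) \<in> carrier ?E" using x r by (simp add: central_extension_simps)
  ultimately have H0: "subgroup {h \<otimes>\<^bsub>?E\<^esub> (x, r) [^]\<^bsub>?E\<^esub> (k::int) | h k. h \<in> B \<times> {\<one>\<^bsub>?M\<^esub>}} ?E" (is "subgroup ?H0 ?E")
    by (rule E.subgroup_adjoin)
  have "fst \<in> hom ?E C" "snd \<in> hom ?E ?M"
    by (auto simp: hom_def central_extension_simps)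
  then have pow: "(x, r) [^]\<^bsub>?E\<^esub> k = (x [^]\<^bsub>C\<^esub> k, r [^]\<^bsub>?M\<^esub> k)" for k :: int
    using hom_int_pow[of fst ?E C "(x, r)" k] hom_int_pow[of snd ?E ?M "(x, r)" k] xr
    by (simp add: prod_eq_iff E.group_axioms C.group_axioms M.group_axioms)
  \<comment> \<open>Well-definedness of the partial homomorphism: if \<open>b x^k = 1\<close>, then
    \<open>x^k\<close> lies in \<open>B\<close>, so \<open>m\<close> divides \<open>k\<close> and
    \<open>r^k\<close> is trivial.\<close>
  have triv: "(\<one>\<^bsub>C\<^esub>, p) = \<one>\<^bsub>?E\<^esub>" if "(\<one>\<^bsub>C\<^esub>, p) \<in> ?H0" for p
  proof -
    obtain b k where bk: "b \<in> B" "(\<one>\<^bsub>C\<^esub>, p) = (b, \<one>\<^bsub>?M\<^esub>) \<otimes>\<^bsub>?E\<^esub> (x [^]\<^bsub>C\<^esub> k, r [^]\<^bsub>?M\<^esub> (k::int))"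
      using \<open>(\<one>\<^bsub>C\<^esub>, p) \<in> ?H0\<close> pow by auto
    then have "\<one>\<^bsub>C\<^esub> = b \<otimes>\<^bsub>C\<^esub> x [^]\<^bsub>C\<^esub> k" and p: "p = r [^]\<^bsub>?M\<^esub> k"
      using r by (simp_all add: central_extension_simps)
    then have "x [^]\<^bsub>C\<^esub> k = inv\<^bsub>C\<^esub> b"
      using Bc[OF bk(1)] x by (metis C.inv_equality C.inv_inv C.int_pow_closed C.inv_closed)
    then have "int m dvd k"
      using m[of k] subgroup.m_inv_closed[OF B bk(1)] by simp
    then show ?thesis using p r by (simp add: central_extension_simps)
  qed
  have "\<exists>\<phi>\<in>carrier C \<rightarrow> carrier ?M.
      (\<forall>a\<in>carrier C. \<forall>b\<in>carrier C. \<phi> (a \<otimes>\<^bsub>C\<^esub> b) = \<phi> a \<otimes>\<^bsub>?M\<^esub> \<phi> b \<otimes>\<^bsub>?M\<^esub> \<one>\<^bsub>?M\<^esub>) \<and>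
      (\<forall>(a, m)\<in>?H0. \<phi> a = m)"
    using symmetric_cocycle_splits[OF C M.comm_group_axioms coc refl rat_mod_int_divisible H0 triv] .
  then obtain \<phi> where \<phi>: "\<phi> \<in> carrier C \<rightarrow> carrier ?M"
    and "(\<forall>a\<in>carrier C. \<forall>b\<in>carrier C. \<phi> (a \<otimes>\<^bsub>C\<^esub> b) = \<phi> a \<otimes>\<^bsub>?M\<^esub> \<phi> b \<otimes>\<^bsub>?M\<^esub> \<one>\<^bsub>?M\<^esub>) \<and>
      (\<forall>(a, m)\<in>?H0. \<phi> a = m)" ..
  then have mult: "\<And>a b. a \<in> carrier C \<Longrightarrow> b \<in> carrier C \<Longrightarrow> \<phi> (a \<otimes>\<^bsub>C\<^esub> b) = \<phi> a \<otimes>\<^bsub>?M\<^esub> \<phi> b \<otimes>\<^bsub>?M\<^esub> \<one>\<^bsub>?M\<^esub>"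
    and graph: "\<And>a m. (a, m) \<in> ?H0 \<Longrightarrow> \<phi> a = m"
    by auto
  have closed: "\<phi> a \<in> carrier ?M" if "a \<in> carrier C" for a
    using \<phi> that by auto
  show ?thesis
  proof (intro bexI[of _ \<phi>] conjI ballI)
    show "\<phi> \<in> hom C ?M"
      by (rule homI) (simp_all add: closed mult)
    have "(b, \<one>\<^bsub>?M\<^esub>) \<in> ?H0" if "b \<in> B" for b
      using that Bc[OF that] by (intro CollectI exI[of _ "(b, \<one>\<^bsub>?M\<^esub>)"] exI[of _ "0::int"])
        (simp add: central_extension_simps)
    then show "\<phi> b = \<one>\<^bsub>?M\<^esub>" if "b \<in> B" for b
      using graph that by blast
    have "(x, r) \<in> ?H0"
      using subgroup.one_closed[OF B] xr x r
      by (intro CollectI exI[of _ "(\<one>\<^bsub>C\<^esub>, \<one>\<^bsub>?M\<^esub>)"] exI[of _ "1::int"])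
        (simp add: central_extension_simps)
    then show "\<phi> x \<noteq> \<one>\<^bsub>?M\<^esub>"
      using graph r by blast
  qed
qed

subsection \<open>The bar complex\<close>

lemma bar_face_closed:
  assumes "group G" and "xs \<in> bar_basis G (Suc n)" and "i \<le> Suc n"
  shows "bar_face G i xs \<in> bar_basis G n"
proof -
  interpret group G by fact
  have len: "length xs = Suc n" and sub: "set xs \<subseteq> carrier G"
    using assms(2) by (auto simp: bar_basis_def)
  have nth: "xs ! j \<in> carrier G" if "j < Suc n" for j
    using that len sub by (metis nth_mem subsetD)
  consider "i = 0" | "i = Suc n" | "0 < i" "i < Suc n"
    using assms(3) by linarith
  then show ?thesis
  proof cases
    case 1
    then show ?thesis using len sub list.set_sel(2)[of xs]
      by (cases xs) (auto simp: bar_face_def bar_basis_def)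
  next
    case 2
    then show ?thesis using len sub
      by (auto simp: bar_face_def bar_basis_def dest: in_set_butlastD)
  next
    case 3
    then show ?thesis using len sub nth[of i] nth[of "i - 1"]
      by (auto simp: bar_face_def bar_basis_def dest: in_set_takeD in_set_dropD)
  qed
qed

lemma bar_face_subgroup: "bar_face (G\<lparr>carrier := A\<rparr>) = bar_face G"
  by (simp add: bar_face_def fun_eq_iff)

lemma bar_basis_subgroup_mono:
  "A \<subseteq> carrier G \<Longrightarrow> bar_basis (G\<lparr>carrier := A\<rparr>) n \<subseteq> bar_basis G n"
  by (auto simp: bar_basis_def)

lemma comm_group_bar_chain_group: "comm_group (bar_chain_group G n)"
  by (simp add: bar_chain_group_def abelian_free_Abelian_group)

lemma bar_boundary_frag_of:
  "bar_boundary G (Suc n) (frag_of xs) =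
    (\<Sum>i\<le>Suc n. frag_cmul ((- 1) ^ i) (frag_of (bar_face G i xs)))"
  by (simp add: bar_boundary_def)

lemma bar_boundary_hom:
  assumes "group G"
  shows "bar_boundary G (Suc n) \<in> hom (bar_chain_group G (Suc n)) (bar_chain_group G n)"
proof (rule homI)
  fix c d assume c: "c \<in> carrier (bar_chain_group G (Suc n))"
  have "Poly_Mapping.keys (\<Sum>i\<le>Suc n. frag_cmul ((- 1) ^ i) (frag_of (bar_face G i xs))) \<subseteq> bar_basis G n"
    if "xs \<in> bar_basis G (Suc n)" for xs
  proof -
    have "(\<Sum>i\<le>Suc n. frag_cmul ((- 1) ^ i) (frag_of (bar_face G i xs))) \<in> carrier (free_Abelian_group (bar_basis G n))"
    proof (rule sum_closed_free_Abelian_group)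
      fix i assume "i \<in> {..Suc n}"
      then have "bar_face G i xs \<in> bar_basis G n"
        using bar_face_closed[OF assms that] by simp
      then show "frag_cmul ((- 1) ^ i) (frag_of (bar_face G i xs)) \<in> carrier (free_Abelian_group (bar_basis G n))"
        using keys_cmul[of "(- 1) ^ i" "frag_of (bar_face G i xs)"] by auto
    qed
    then show ?thesis by simp
  qed
  then show "bar_boundary G (Suc n) c \<in> carrier (bar_chain_group G n)"
    using c keys_frag_extend[of "\<lambda>xs. \<Sum>i\<le>Suc n. frag_cmul ((- 1) ^ i) (frag_of (bar_face G i xs))" c]
    by (fastforce simp: bar_boundary_def bar_chain_group_def)
  show "bar_boundary G (Suc n) (c \<otimes>\<^bsub>bar_chain_group G (Suc n)\<^esub> d) =
      bar_boundary G (Suc n) c \<otimes>\<^bsub>bar_chain_group G n\<^esub> bar_boundary G (Suc n) d"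
    by (simp add: bar_boundary_def bar_chain_group_def frag_extend_add)
qed

lemma integral_boundaries_subgroup:
  fixes G :: "('a, 'b) monoid_scheme"
  assumes "group G"
  shows "subgroup (integral_boundaries G n) (bar_chain_group G n)"
proof -
  have "group (bar_chain_group G k)" for k
    using comm_group_bar_chain_group by (rule comm_group.axioms)
  then interpret group_hom "bar_chain_group G (Suc n)" "bar_chain_group G n" "bar_boundary G (Suc n)"
    using bar_boundary_hom[OF assms] by (simp add: group_hom_def group_hom_axioms_def)
  show ?thesis
    using img_is_subgroup by (simp add: integral_boundaries_def)
qed

section \<open>Homomorphisms on chain groups and the cochains they define\<close>

lemma hom_free_Abelian_group_eqI:
  assumes "comm_group M" and f: "f \<in> hom (free_Abelian_group S) M" and g: "g \<in> hom (free_Abelian_group S) M"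
    and eq: "\<And>x. x \<in> S \<Longrightarrow> f (frag_of x) = g (frag_of x)"
    and c: "c \<in> carrier (free_Abelian_group S)"
  shows "f c = g c"
proof -
  interpret M: comm_group M by fact
  interpret f: group_hom "free_Abelian_group S" M f
    using f by (simp add: group_hom_def group_hom_axioms_def M.group_axioms)
  interpret g: group_hom "free_Abelian_group S" M g
    using g by (simp add: group_hom_def group_hom_axioms_def M.group_axioms)
  have diff: "h (x - y) = h x \<otimes>\<^bsub>M\<^esub> inv\<^bsub>M\<^esub> h y"
    if "h \<in> hom (free_Abelian_group S) M" "Poly_Mapping.keys x \<subseteq> S" "Poly_Mapping.keys y \<subseteq> S" for h x y
  proof -
    interpret h: group_hom "free_Abelian_group S" M h
      using that by (simp add: group_hom_def group_hom_axioms_def M.group_axioms)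
    have "h (x \<otimes>\<^bsub>free_Abelian_group S\<^esub> inv\<^bsub>free_Abelian_group S\<^esub> y) = h x \<otimes>\<^bsub>M\<^esub> inv\<^bsub>M\<^esub> h y"
      using that h.hom_mult[of x "inv\<^bsub>free_Abelian_group S\<^esub> y"] h.hom_inv[of y] by simp
    then show ?thesis using that by simp
  qed
  have "Poly_Mapping.keys c \<subseteq> S" using c by simp
  then show ?thesis
  proof (rule free_Abelian_group_induct)
    show "f 0 = g 0" using f.hom_one g.hom_one by simp
    show "f (x - y) = g (x - y)"
      if "Poly_Mapping.keys x \<subseteq> S" "Poly_Mapping.keys y \<subseteq> S" "f x = g x" "f y = g y" for x y
      using that by (simp add: diff[OF f] diff[OF g])
  qed (rule eq)
qed

lemma hom_free_Abelian_group_sum: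
  assumes "comm_group M" and f: "f \<in> hom (free_Abelian_group S) M" and "finite I"
    and x: "\<And>i. i \<in> I \<Longrightarrow> x i \<in> S"
  shows "f (\<Sum>i\<in>I. frag_cmul (z i) (frag_of (x i))) = (\<Otimes>\<^bsub>M\<^esub>i\<in>I. f (frag_of (x i)) [^]\<^bsub>M\<^esub> z i)"
  using assms(3) x
proof (induction I)
  case empty
  interpret M: comm_group M by fact
  interpret f: group_hom "free_Abelian_group S" M f
    using f by (simp add: group_hom_def group_hom_axioms_def M.group_axioms)
  show ?case using f.hom_one by simp
next
  case (insert j I)
  interpret M: comm_group M by fact
  interpret f: group_hom "free_Abelian_group S" M f
    using f by (simp add: group_hom_def group_hom_axioms_def M.group_axioms)
  have closed: "f (frag_of (x i)) \<in> carrier M" if "i \<in> insert j I" for i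
    using insert.prems that by (intro f.hom_closed) simp
  have j: "frag_of (x j) \<in> carrier (free_Abelian_group S)"
    using insert.prems by simp
  have "frag_cmul (z j) (frag_of (x j)) = frag_of (x j) [^]\<^bsub>free_Abelian_group S\<^esub> z j"
    using insert.prems by simp
  then have fj: "f (frag_cmul (z j) (frag_of (x j))) = f (frag_of (x j)) [^]\<^bsub>M\<^esub> z j"
    and cj: "frag_cmul (z j) (frag_of (x j)) \<in> carrier (free_Abelian_group S)"
    using f.hom_int_pow[OF j] f.int_pow_closed[OF j] by simp_all
  have cs: "(\<Sum>i\<in>I. frag_cmul (z i) (frag_of (x i))) \<in> carrier (free_Abelian_group S)"
  proof (rule sum_closed_free_Abelian_group)
    show "frag_cmul (z i) (frag_of (x i)) \<in> carrier (free_Abelian_group S)" if "i \<in> I" for i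
      using insert.prems that keys_cmul[of "z i" "frag_of (x i)"] by auto
  qed
  show ?case
    using insert f.hom_mult[OF cj cs] closed
    by (simp add: fj Pi_def)
qed

text \<open>The passage from \<open>Hom(C_n, M)\<close> to \<open>n\<close>-cochains given by
  restriction to basis elements; it is cut off outside the basis since cochains are
  extensional.\<close>

definition hom_cochain ::
    "('a, 'b) monoid_scheme \<Rightarrow> nat \<Rightarrow> (('a list \<Rightarrow>\<^sub>0 int) \<Rightarrow> 'm) \<Rightarrow> 'a list \<Rightarrow> 'm" where
  "hom_cochain G n \<psi> = (\<lambda>xs\<in>bar_basis G n. \<psi> (frag_of xs))"

lemma hom_cochain_in_cochain_group:
  assumes "\<psi> \<in> hom (bar_chain_group G n) M"
  shows "hom_cochain G n \<psi> \<in> carrier (cochain_group G M n)"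
  using hom_carrier[OF assms]
  by (auto simp: hom_cochain_def cochain_group_def bar_chain_group_def)

text \<open>Duality: a homomorphism turns the alternating sum of faces in the boundary into the
  alternating product in the coboundary.\<close>

lemma coboundary_map_hom_cochain:
  assumes "group G" and "comm_group M" and \<psi>: "\<psi> \<in> hom (bar_chain_group G n) M"
  shows "coboundary_map G M n (hom_cochain G n \<psi>) =
    (\<lambda>xs\<in>bar_basis G (Suc n). \<psi> (bar_boundary G (Suc n) (frag_of xs)))"
  unfolding coboundary_map_def Suc_eq_plus1[symmetric]
proof (rule restrict_ext)
  interpret M: comm_group M by fact
  fix xs assume "xs \<in> bar_basis G (Suc n)"
  then have face: "bar_face G i xs \<in> bar_basis G n" if "i \<le> Suc n" for i
    using bar_face_closed[OF assms(1) _ that] by simp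
  have "\<psi> (bar_boundary G (Suc n) (frag_of xs)) =
      (\<Otimes>\<^bsub>M\<^esub>i\<in>{..Suc n}. \<psi> (frag_of (bar_face G i xs)) [^]\<^bsub>M\<^esub> ((- 1) ^ i :: int))"
    unfolding bar_boundary_frag_of
    by (rule hom_free_Abelian_group_sum[OF assms(2) \<psi>[unfolded bar_chain_group_def]])
      (simp_all add: face)
  also have "\<dots> = (\<Otimes>\<^bsub>M\<^esub>i\<in>{..Suc n}. hom_cochain G n \<psi> (bar_face G i xs) [^]\<^bsub>M\<^esub> ((- 1) ^ i :: int))"
    using face hom_carrier[OF \<psi>]
    by (intro M.finprod_cong')
      (auto simp: hom_cochain_def bar_chain_group_def Pi_def intro!: M.int_pow_closed)
  finally show "(\<Otimes>\<^bsub>M\<^esub>i\<in>{..Suc n}. hom_cochain G n \<psi> (bar_face G i xs) [^]\<^bsub>M\<^esub> ((- 1) ^ i :: int)) =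
    \<psi> (bar_boundary G (Suc n) (frag_of xs))" ..
qed

lemma hom_cochain_cocycle:
  assumes "group G" and "comm_group M" and \<psi>: "\<psi> \<in> hom (bar_chain_group G n) M"
    and van: "\<And>c. c \<in> integral_boundaries G n \<Longrightarrow> \<psi> c = \<one>\<^bsub>M\<^esub>"
  shows "hom_cochain G n \<psi> \<in> cocycles G M n"
proof -
  have "\<psi> (bar_boundary G (Suc n) (frag_of xs)) = \<one>\<^bsub>M\<^esub>" if "xs \<in> bar_basis G (Suc n)" for xs
    using that by (intro van) (simp add: integral_boundaries_def bar_chain_group_def)
  then have "coboundary_map G M n (hom_cochain G n \<psi>) = \<one>\<^bsub>cochain_group G M (n + 1)\<^esub>"
    unfolding coboundary_map_hom_cochain[OF assms(1-3)]
    by (auto simp: cochain_group_def)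
  then show ?thesis
    using hom_cochain_in_cochain_group[OF \<psi>] by (simp add: cocycles_def kernel_def)
qed

text \<open>If the cochain of \<open>\<psi>\<close> is the coboundary of \<open>h\<close>, extend
  \<open>h\<close> to a homomorphism \<open>\<eta>\<close> on the free group of
  \<open>n\<close>-chains. Then \<open>\<psi>\<close> and \<open>\<eta>\<close> composed with the
  boundary agree on generators, hence everywhere, and a cycle has boundary zero.\<close>

lemma hom_cochain_coboundary_vanishes:
  assumes "group G" and "comm_group M" and \<psi>: "\<psi> \<in> hom (bar_chain_group G (Suc n)) M"
    and cob: "hom_cochain G (Suc n) \<psi> \<in> coboundaries G M (Suc n)"
    and z: "z \<in> integral_cycles G (Suc n)"
  shows "\<psi> z = \<one>\<^bsub>M\<^esub>"
proof -
  interpret M: comm_group M by fact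
  obtain h where h: "h \<in> carrier (cochain_group G M n)"
    and eq: "hom_cochain G (Suc n) \<psi> = coboundary_map G M n h"
    using cob by (auto simp: coboundaries_def)
  have "h ` bar_basis G n \<subseteq> carrier M"
    using h by (auto simp: cochain_group_def)
  then obtain \<eta> where \<eta>: "\<eta> \<in> hom (bar_chain_group G n) M"
    and \<eta>h: "\<And>xs. xs \<in> bar_basis G n \<Longrightarrow> \<eta> (frag_of xs) = h xs"
    unfolding bar_chain_group_def using M.free_Abelian_group_universal by metis
  have "hom_cochain G n \<eta> = h"
    using h \<eta>h by (auto simp: hom_cochain_def cochain_group_def PiE_def extensional_def fun_eq_iff)
  then have eq': "\<psi> (frag_of xs) = (\<eta> \<circ> bar_boundary G (Suc n)) (frag_of xs)"
    if "xs \<in> bar_basis G (Suc n)" for xs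
    using that coboundary_map_hom_cochain[OF assms(1,2) \<eta>] eq
    by (metis comp_apply hom_cochain_def restrict_apply')
  have "\<psi> z = (\<eta> \<circ> bar_boundary G (Suc n)) z"
  proof (rule hom_free_Abelian_group_eqI[OF assms(2)])
    show "\<psi> \<in> hom (free_Abelian_group (bar_basis G (Suc n))) M"
      using \<psi> by (simp only: bar_chain_group_def)
    show "\<eta> \<circ> bar_boundary G (Suc n) \<in> hom (free_Abelian_group (bar_basis G (Suc n))) M"
      using Group.hom_compose[OF bar_boundary_hom[OF assms(1)] \<eta>] by (simp only: bar_chain_group_def)
    show "z \<in> carrier (free_Abelian_group (bar_basis G (Suc n)))"
      using z by (simp add: integral_cycles_def kernel_def bar_chain_group_def)
  qed (rule eq')
  also have "\<dots> = \<eta> \<one>\<^bsub>bar_chain_group G n\<^esub>"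
    using z by (simp add: integral_cycles_def kernel_def)
  also have "\<dots> = \<one>\<^bsub>M\<^esub>"
    using \<eta> by (intro hom_one) (simp_all add: bar_chain_group_def M.group_axioms)
  finally show ?thesis .
qed

section \<open>Coboundaries, their restriction to subgroups, and trivial Bogomolov
  multiplier\<close>

lemma group_cochain_group: "group M \<Longrightarrow> group (cochain_group G M n)"
  by (simp add: cochain_group_def)

lemma coboundary_map_hom:
  assumes "group G" and "comm_group M"
  shows "coboundary_map G M n \<in> hom (cochain_group G M n) (cochain_group G M (Suc n))"
proof (rule homI)
  interpret M: comm_group M by fact
  fix f g assume f: "f \<in> carrier (cochain_group G M n)" and g: "g \<in> carrier (cochain_group G M n)"
  have closed: "k (bar_face G i xs) \<in> carrier M"
    if "k \<in> carrier (cochain_group G M n)" "xs \<in> bar_basis G (Suc n)" "i \<le> Suc n" for k i xs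
    using bar_face_closed[OF assms(1) that(2,3)] that(1) by (auto simp: cochain_group_def)
  show "coboundary_map G M n f \<in> carrier (cochain_group G M (Suc n))"
    using closed[OF f] by (auto simp: coboundary_map_def cochain_group_def intro!: M.finprod_closed M.int_pow_closed)
  show "coboundary_map G M n (f \<otimes>\<^bsub>cochain_group G M n\<^esub> g) =
      coboundary_map G M n f \<otimes>\<^bsub>cochain_group G M (Suc n)\<^esub> coboundary_map G M n g"
  proof
    fix xs
    show "coboundary_map G M n (f \<otimes>\<^bsub>cochain_group G M n\<^esub> g) xs =
      (coboundary_map G M n f \<otimes>\<^bsub>cochain_group G M (Suc n)\<^esub> coboundary_map G M n g) xs"
    proof (cases "xs \<in> bar_basis G (Suc n)")
      case True
      have "(\<Otimes>\<^bsub>M\<^esub>i\<in>{..Suc n}. (f \<otimes>\<^bsub>cochain_group G M n\<^esub> g) (bar_face G i xs) [^]\<^bsub>M\<^esub> ((- 1) ^ i :: int))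
          = (\<Otimes>\<^bsub>M\<^esub>i\<in>{..Suc n}. f (bar_face G i xs) [^]\<^bsub>M\<^esub> ((- 1) ^ i :: int) \<otimes>\<^bsub>M\<^esub>
              g (bar_face G i xs) [^]\<^bsub>M\<^esub> ((- 1) ^ i :: int))"
        using closed[OF f True] closed[OF g True] bar_face_closed[OF assms(1) True]
        by (intro M.finprod_cong') (auto simp: cochain_group_def M.int_pow_distrib)
      also have "\<dots> = (\<Otimes>\<^bsub>M\<^esub>i\<in>{..Suc n}. f (bar_face G i xs) [^]\<^bsub>M\<^esub> ((- 1) ^ i :: int)) \<otimes>\<^bsub>M\<^esub>
          (\<Otimes>\<^bsub>M\<^esub>i\<in>{..Suc n}. g (bar_face G i xs) [^]\<^bsub>M\<^esub> ((- 1) ^ i :: int))"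
        using closed[OF f True] closed[OF g True] by (intro M.finprod_multf) auto
      finally show ?thesis
        using True by (simp add: coboundary_map_def cochain_group_def)
    qed (simp add: coboundary_map_def cochain_group_def)
  qed
qed

lemma coboundaries_subgroup:
  assumes "group G" and "comm_group M"
  shows "subgroup (coboundaries G M (Suc n)) (cochain_group G M (Suc n))"
proof -
  interpret group_hom "cochain_group G M n" "cochain_group G M (Suc n)" "coboundary_map G M n"
    using coboundary_map_hom[OF assms] comm_group.axioms(2)[OF assms(2)]
    by (simp add: group_hom_def group_hom_axioms_def group_cochain_group)
  show ?thesis using img_is_subgroup by (simp add: coboundaries_def)
qed

text \<open>Faces of tuples from \<open>A\<close> are again tuples from \<open>A\<close>, so
  restriction commutes with the coboundary map.\<close>

lemma restrict_coboundary:
  assumes G: "group G" and M: "comm_group M" and A: "subgroup A G"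
    and b: "b \<in> coboundaries G M (Suc n)"
  shows "restrict b (bar_basis (G\<lparr>carrier := A\<rparr>) (Suc n)) \<in> coboundaries (G\<lparr>carrier := A\<rparr>) M (Suc n)"
proof -
  interpret M: comm_group M by fact
  let ?H = "G\<lparr>carrier := A\<rparr>"
  have H: "group ?H" using group.subgroup_imp_group[OF G A] .
  have sub: "bar_basis ?H k \<subseteq> bar_basis G k" for k
    using subgroup.subset[OF A] by (rule bar_basis_subgroup_mono)
  obtain h where h: "h \<in> carrier (cochain_group G M n)" and bh: "b = coboundary_map G M n h"
    using b by (auto simp: coboundaries_def)
  have "restrict b (bar_basis ?H (Suc n)) = coboundary_map ?H M n (restrict h (bar_basis ?H n))"
  proof
    fix xs
    show "restrict b (bar_basis ?H (Suc n)) xs = coboundary_map ?H M n (restrict h (bar_basis ?H n)) xs"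
    proof (cases "xs \<in> bar_basis ?H (Suc n)")
      case True
      have face: "bar_face G i xs \<in> bar_basis ?H n" if "i \<le> Suc n" for i
        using bar_face_closed[OF H True that] by (simp add: bar_face_subgroup)
      have "(\<Otimes>\<^bsub>M\<^esub>i\<in>{..Suc n}. h (bar_face G i xs) [^]\<^bsub>M\<^esub> ((- 1) ^ i :: int)) =
          (\<Otimes>\<^bsub>M\<^esub>i\<in>{..Suc n}. restrict h (bar_basis ?H n) (bar_face G i xs) [^]\<^bsub>M\<^esub> ((- 1) ^ i :: int))"
      proof (rule M.finprod_cong'[OF refl])
        have "h (bar_face G i xs) \<in> carrier M" if "i \<le> Suc n" for i
          using h face[OF that] sub[of n] by (auto simp: cochain_group_def)
        then show "(\<lambda>i. restrict h (bar_basis ?H n) (bar_face G i xs) [^]\<^bsub>M\<^esub> ((- 1) ^ i :: int)) \<in> {..Suc n} \<rightarrow> carrier M"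
          using face by (simp add: Pi_def)
      qed (use face in simp)
      moreover have "xs \<in> bar_basis G (Suc n)"
        using True sub by blast
      ultimately show ?thesis
        using True by (simp add: bh coboundary_map_def bar_face_subgroup)
    qed (simp add: coboundary_map_def)
  qed
  moreover have "restrict h (bar_basis ?H n) \<in> carrier (cochain_group ?H M n)"
    using h sub[of n] by (auto simp: cochain_group_def)
  ultimately show ?thesis by (auto simp: coboundaries_def)
qed

text \<open>Cosets are computed in the ambient cochain group, so \<open>\<delta>\<delta> = 0\<close> is not needed.\<close>

lemma bogomolov_multiplier_trivialD:
  fixes G :: "('a, 'b) monoid_scheme"
  assumes G: "group G"
    and triv: "bogomolov_multiplier G = {\<one>\<^bsub>cohomology_group G rat_mod_int_group 2\<^esub>}"
    and f: "f \<in> cocycles G rat_mod_int_group 2"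
    and loc: "\<And>A. A \<in> abelian_subgroups G \<Longrightarrow>
      restrict f (bar_basis (G\<lparr>carrier := A\<rparr>) 2) \<in> coboundaries (G\<lparr>carrier := A\<rparr>) rat_mod_int_group 2"
  shows "f \<in> coboundaries G rat_mod_int_group 2"
proof -
  let ?M = rat_mod_int_group
  note M = comm_group_rat_mod_int
  have coset: "coboundaries K ?M 2 #>\<^bsub>cocycle_group K ?M 2\<^esub> x = coboundaries K ?M 2 #>\<^bsub>cochain_group K ?M 2\<^esub> x"
    for K :: "('a, 'b) monoid_scheme" and x
    by (simp add: cocycle_group_def r_coset_def)
  have sub: "subgroup (coboundaries K ?M 2) (cochain_group K ?M 2)" if "group K" for K :: "('a, 'b) monoid_scheme"
    using coboundaries_subgroup[OF that M, of 1] by (simp add: numeral_2_eq_2)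
  have grp: "group (cochain_group K ?M 2)" for K :: "('a, 'b) monoid_scheme"
    using comm_group.axioms(2)[OF M] by (rule group_cochain_group)
  have fc: "f \<in> carrier (cochain_group G ?M 2)" using f by (simp add: cocycles_def kernel_def)
  let ?c = "coboundaries G ?M 2 #>\<^bsub>cocycle_group G ?M 2\<^esub> f"
  have "?c \<in> carrier (cohomology_group G ?M 2)"
    using f by (auto simp: cohomology_group_def FactGroup_def RCOSETS_def cocycle_group_def)
  moreover have "cohomology_restriction G ?M 2 A ?c = \<one>\<^bsub>cohomology_group (G\<lparr>carrier := A\<rparr>) ?M 2\<^esub>"
    if A: "A \<in> abelian_subgroups G" for A
  proof -
    let ?H = "G\<lparr>carrier := A\<rparr>"
    have sA: "subgroup A G" using A by (simp add: abelian_subgroups_def)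
    have H: "group ?H" using group.subgroup_imp_group[OF G sA] .
    \<comment> \<open>This is checked for every member \<open>g\<close> of the class of
      \<open>f\<close>, so that the image set in \<open>cohomology_restriction\<close> is a
      singleton and \<open>the_elem\<close> has a determined value.\<close>
    have "coboundaries ?H ?M 2 #>\<^bsub>cocycle_group ?H ?M 2\<^esub> restrict g (bar_basis ?H 2) = coboundaries ?H ?M 2"
      if g: "g \<in> ?c" for g
    proof -
      obtain b where b: "b \<in> coboundaries G ?M 2" "g = b \<otimes>\<^bsub>cochain_group G ?M 2\<^esub> f"
        using g unfolding coset by (auto simp: r_coset_def)
      have "restrict g (bar_basis ?H 2) =
          restrict b (bar_basis ?H 2) \<otimes>\<^bsub>cochain_group ?H ?M 2\<^esub> restrict f (bar_basis ?H 2)"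
        using bar_basis_subgroup_mono[OF subgroup.subset[OF sA], of 2]
        by (auto simp: b(2) cochain_group_def fun_eq_iff)
      moreover have "restrict b (bar_basis ?H 2) \<in> coboundaries ?H ?M 2"
        using restrict_coboundary[OF G M sA, of b 1] b(1) by (simp add: numeral_2_eq_2)
      ultimately have "restrict g (bar_basis ?H 2) \<in> coboundaries ?H ?M 2"
        using loc[OF A] subgroup.m_closed[OF sub[OF H]] by simp
      then show ?thesis
        unfolding coset by (rule subgroup.rcos_const[OF sub[OF H] grp])
    qed
    moreover have "f \<in> ?c"
      unfolding coset by (rule group.rcos_self[OF grp fc sub[OF G]])
    ultimately have "(\<lambda>g. coboundaries ?H ?M 2 #>\<^bsub>cocycle_group ?H ?M 2\<^esub> restrict g (bar_basis ?H 2)) ` ?c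
        = {coboundaries ?H ?M 2}"
      by auto
    then show ?thesis
      by (simp add: cohomology_restriction_def Let_def cohomology_group_def FactGroup_def)
  qed
  ultimately have "?c \<in> bogomolov_multiplier G"
    by (simp add: bogomolov_multiplier_def kernel_def cong: restrict_cong)
  \<comment> \<open>The identity of the cohomology group is the coset of coboundaries itself; a
    coset equal to its subgroup contains its representative there.\<close>
  then have "?c = coboundaries G ?M 2"
    unfolding triv by (simp add: cohomology_group_def FactGroup_def)
  then show ?thesis
    unfolding coset by (rule group.coset_join1[OF grp _ fc sub[OF G]])
qed

subsection \<open>Exponents and the multiple of a cycle\<close>

lemma group_exponent_finite:
  assumes "group G" and "finite (carrier G)"
  shows "group_exponent G > 0"
    and "g \<in> carrier G \<Longrightarrow> g [^]\<^bsub>G\<^esub> group_exponent G = \<one>\<^bsub>G\<^esub>"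
proof -
  interpret group G by fact
  let ?P = "\<lambda>n::nat. n > 0 \<and> (\<forall>g\<in>carrier G. g [^]\<^bsub>G\<^esub> n = \<one>\<^bsub>G\<^esub>)"
  have ex: "\<exists>n. ?P n"
    using pow_order_eq_1 assms(2) order_gt_0_iff_finite by blast
  then have "group_exponent G = (LEAST n. ?P n)"
    by (simp add: group_exponent_def)
  then show "group_exponent G > 0" "g \<in> carrier G \<Longrightarrow> g [^]\<^bsub>G\<^esub> group_exponent G = \<one>\<^bsub>G\<^esub>"
    using LeastI_ex[OF ex] by simp_all
qed

text \<open>With \<open>m\<close> the least positive exponent on \<open>S\<close>, the remainder
  \<open>e mod m\<close> also kills \<open>S\<close>, so it is zero. The power laws come from the
  ambient group \<open>Q\<close>; in the application \<open>Q\<close> is chains modulo boundaries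
  and \<open>S\<close> the classes of cycles.\<close>

lemma group_exponent_dvd:
  assumes "group Q" and S: "S \<subseteq> carrier Q" and e: "e > 0"
    and pow: "\<And>g. g \<in> S \<Longrightarrow> g [^]\<^bsub>Q\<^esub> e = \<one>\<^bsub>Q\<^esub>"
  shows "group_exponent (Q\<lparr>carrier := S\<rparr>) dvd e"
proof -
  interpret group Q by fact
  let ?P = "\<lambda>n::nat. n > 0 \<and> (\<forall>g\<in>S. g [^]\<^bsub>Q\<^esub> n = \<one>\<^bsub>Q\<^esub>)"
  have P: "?P e" using e pow by simp
  define m where "m = (LEAST n. ?P n)"
  have m: "?P m" unfolding m_def by (rule LeastI[of ?P, OF P])
  have "g [^]\<^bsub>Q\<^esub> (e mod m) = \<one>\<^bsub>Q\<^esub>" if g: "g \<in> S" for g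
  proof -
    have gc: "g \<in> carrier Q" using g S by auto
    have "g [^]\<^bsub>Q\<^esub> (m * (e div m)) \<otimes>\<^bsub>Q\<^esub> g [^]\<^bsub>Q\<^esub> (e mod m) = \<one>\<^bsub>Q\<^esub>"
      using gc pow[OF g] by (simp add: nat_pow_mult)
    then show ?thesis using gc m g by (simp flip: nat_pow_pow)
  qed
  moreover have "\<not> ?P (e mod m)"
    using not_less_Least[of "e mod m" ?P] m by (simp add: m_def[symmetric])
  ultimately have "e mod m = 0" by auto
  moreover have "\<exists>n::nat>0. \<forall>g\<in>S. g [^]\<^bsub>Q\<^esub> n = \<one>\<^bsub>Q\<^esub>"
    using P by blast
  then have "group_exponent (Q\<lparr>carrier := S\<rparr>) = m"
    by (simp add: group_exponent_def m_def flip: nat_pow_consistent)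
  ultimately show ?thesis by auto
qed

section \<open>Translation between two-variable cocycles and bar cochains of degree two\<close>

lemma bar_basis_2_cases:
  assumes "xs \<in> bar_basis G 2"
  obtains a b where "xs = [a, b]" "a \<in> carrier G" "b \<in> carrier G"
proof -
  have "length xs = Suc (Suc 0)" "set xs \<subseteq> carrier G"
    using assms by (auto simp: bar_basis_def)
  then show ?thesis
    by (auto simp: length_Suc_conv intro: that)
qed

text \<open>Evaluating \<open>\<phi>\<close> on the boundary of \<open>[a, b, c]\<close> gives an
  alternating product over four faces; setting it equal to \<open>1\<close> and moving the two
  inverses to the other side is the cocycle identity.\<close>

lemma hom_vanishing_on_boundaries_cocycle2:
  assumes "group G" and "comm_group M" and \<phi>: "\<phi> \<in> hom (bar_chain_group G 2) M"
    and van: "\<And>c. c \<in> integral_boundaries G 2 \<Longrightarrow> \<phi> c = \<one>\<^bsub>M\<^esub>"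
  shows "cocycle2 G M (\<lambda>a b. \<phi> (frag_of [a, b]))"
proof -
  interpret G: group G by fact
  interpret M: comm_group M by fact
  have closed: "\<phi> (frag_of [a, b]) \<in> carrier M" if "a \<in> carrier G" "b \<in> carrier G" for a b
    using hom_carrier[OF \<phi>] that by (force simp: bar_chain_group_def bar_basis_def)
  have alternating: "(\<Otimes>\<^bsub>M\<^esub>i\<in>{..Suc 2}. p i [^]\<^bsub>M\<^esub> ((- 1) ^ i :: int)) =
      p 0 \<otimes>\<^bsub>M\<^esub> (inv\<^bsub>M\<^esub> p 1 \<otimes>\<^bsub>M\<^esub> (p 2 \<otimes>\<^bsub>M\<^esub> inv\<^bsub>M\<^esub> p 3))"
    if p: "\<And>i. i \<le> Suc 2 \<Longrightarrow> p i \<in> carrier M" for p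
  proof -
    have "{..Suc 2} = {0, 1, 2, 3::nat}" by auto
    moreover have "p 0 \<in> carrier M" "p 1 \<in> carrier M" "p 2 \<in> carrier M" "p 3 \<in> carrier M"
      using p by simp_all
    ultimately show ?thesis
      by (simp only:) (simp add: Pi_def M.int_pow_neg)
  qed
  have cancel: "p \<otimes>\<^bsub>M\<^esub> r = q \<otimes>\<^bsub>M\<^esub> s"
    if eq: "p \<otimes>\<^bsub>M\<^esub> (inv\<^bsub>M\<^esub> q \<otimes>\<^bsub>M\<^esub> (r \<otimes>\<^bsub>M\<^esub> inv\<^bsub>M\<^esub> s)) = \<one>\<^bsub>M\<^esub>"
      and c: "p \<in> carrier M" "q \<in> carrier M" "r \<in> carrier M" "s \<in> carrier M" for p q r s
  proof -
    have "(p \<otimes>\<^bsub>M\<^esub> (inv\<^bsub>M\<^esub> q \<otimes>\<^bsub>M\<^esub> (r \<otimes>\<^bsub>M\<^esub> inv\<^bsub>M\<^esub> s))) \<otimes>\<^bsub>M\<^esub> (q \<otimes>\<^bsub>M\<^esub> s)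
        = (p \<otimes>\<^bsub>M\<^esub> r) \<otimes>\<^bsub>M\<^esub> ((q \<otimes>\<^bsub>M\<^esub> inv\<^bsub>M\<^esub> q) \<otimes>\<^bsub>M\<^esub> (s \<otimes>\<^bsub>M\<^esub> inv\<^bsub>M\<^esub> s))"
      using c by (simp only: M.m_ac M.m_closed M.inv_closed)
    then show ?thesis using c by (simp add: eq)
  qed
  have "\<phi> (frag_of [b, c]) \<otimes>\<^bsub>M\<^esub> \<phi> (frag_of [a, b \<otimes>\<^bsub>G\<^esub> c]) =
      \<phi> (frag_of [a \<otimes>\<^bsub>G\<^esub> b, c]) \<otimes>\<^bsub>M\<^esub> \<phi> (frag_of [a, b])"
    if abc: "a \<in> carrier G" "b \<in> carrier G" "c \<in> carrier G" for a b c
  proof -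
    have xs: "[a, b, c] \<in> bar_basis G (Suc 2)"
      using abc by (simp add: bar_basis_def)
    have face: "bar_face G i [a, b, c] \<in> bar_basis G 2" if "i \<le> Suc 2" for i
      by (rule bar_face_closed[OF assms(1) xs that])
    have "\<phi> (bar_boundary G (Suc 2) (frag_of [a, b, c])) = \<one>\<^bsub>M\<^esub>"
      using xs by (intro van) (simp add: integral_boundaries_def bar_chain_group_def)
    moreover have "\<phi> (bar_boundary G (Suc 2) (frag_of [a, b, c])) =
        (\<Otimes>\<^bsub>M\<^esub>i\<in>{..Suc 2}. \<phi> (frag_of (bar_face G i [a, b, c])) [^]\<^bsub>M\<^esub> ((- 1) ^ i :: int))"
      unfolding bar_boundary_frag_of
      by (rule hom_free_Abelian_group_sum[OF assms(2) \<phi>[unfolded bar_chain_group_def]])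
        (simp_all add: face)
    ultimately have "\<phi> (frag_of (bar_face G 0 [a, b, c])) \<otimes>\<^bsub>M\<^esub>
        (inv\<^bsub>M\<^esub> \<phi> (frag_of (bar_face G 1 [a, b, c])) \<otimes>\<^bsub>M\<^esub>
        (\<phi> (frag_of (bar_face G 2 [a, b, c])) \<otimes>\<^bsub>M\<^esub>
         inv\<^bsub>M\<^esub> \<phi> (frag_of (bar_face G 3 [a, b, c])))) = \<one>\<^bsub>M\<^esub>"
      using alternating[of "\<lambda>i. \<phi> (frag_of (bar_face G i [a, b, c]))"] face hom_carrier[OF \<phi>]
      by (simp add: bar_chain_group_def image_subset_iff)
    moreover have "bar_face G 0 [a, b, c] = [b, c]" "bar_face G 1 [a, b, c] = [a \<otimes>\<^bsub>G\<^esub> b, c]"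
      "bar_face G 2 [a, b, c] = [a, b \<otimes>\<^bsub>G\<^esub> c]" "bar_face G 3 [a, b, c] = [a, b]"
      by (simp_all add: bar_face_def)
    ultimately have "\<phi> (frag_of [b, c]) \<otimes>\<^bsub>M\<^esub> (inv\<^bsub>M\<^esub> \<phi> (frag_of [a \<otimes>\<^bsub>G\<^esub> b, c]) \<otimes>\<^bsub>M\<^esub>
        (\<phi> (frag_of [a, b \<otimes>\<^bsub>G\<^esub> c]) \<otimes>\<^bsub>M\<^esub> inv\<^bsub>M\<^esub> \<phi> (frag_of [a, b]))) = \<one>\<^bsub>M\<^esub>"
      by (simp only:)
    then show ?thesis
      by (rule cancel) (use abc in \<open>simp_all add: closed\<close>)
  qed
  then show ?thesis
    unfolding cocycle2_def using closed by blast
qed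

text \<open>The faces of \<open>[a, b]\<close> are \<open>[b]\<close>, \<open>[a b]\<close> and
  \<open>[a]\<close> with signs plus, minus, plus, which gives the order of the factors in
  \<open>eq\<close>.\<close>

lemma coboundary2I:
  assumes "group H" and "comm_group M" and h: "h \<in> carrier H \<rightarrow> carrier M"
    and f: "f \<in> extensional (bar_basis H 2)"
    and eq: "\<And>a b. a \<in> carrier H \<Longrightarrow> b \<in> carrier H \<Longrightarrow>
      f [a, b] = h b \<otimes>\<^bsub>M\<^esub> inv\<^bsub>M\<^esub> h (a \<otimes>\<^bsub>H\<^esub> b) \<otimes>\<^bsub>M\<^esub> h a"
  shows "f \<in> coboundaries H M 2"
proof -
  interpret H: group H by fact
  interpret M: comm_group M by fact
  let ?h = "\<lambda>xs\<in>bar_basis H 1. h (hd xs)"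
  have closed: "h a \<in> carrier M" if "a \<in> carrier H" for a
    using h that by auto
  have "f = coboundary_map H M 1 ?h"
  proof
    fix xs
    show "f xs = coboundary_map H M 1 ?h xs"
    proof (cases "xs \<in> bar_basis H 2")
      case True
      then obtain a b where xs: "xs = [a, b]" and ab: "a \<in> carrier H" "b \<in> carrier H"
        by (rule bar_basis_2_cases)
      have "{..2} = {0, 1, 2::nat}" by auto
      moreover have "h b \<otimes>\<^bsub>M\<^esub> inv\<^bsub>M\<^esub> h (a \<otimes>\<^bsub>H\<^esub> b) \<otimes>\<^bsub>M\<^esub> h a =
          h b \<otimes>\<^bsub>M\<^esub> (inv\<^bsub>M\<^esub> h (a \<otimes>\<^bsub>H\<^esub> b) \<otimes>\<^bsub>M\<^esub> h a)"
        using ab by (simp add: closed M.m_assoc)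
      ultimately show ?thesis
        using True ab eq[OF ab]
        by (simp add: xs coboundary_map_def numeral_2_eq_2[symmetric] bar_face_def bar_basis_def
            closed M.int_pow_neg Pi_def)
    next
      case False
      then show ?thesis
        using f by (simp add: coboundary_map_def extensional_def numeral_2_eq_2)
    qed
  qed
  moreover have "?h \<in> carrier (cochain_group H M 1)"
    using closed by (auto simp: cochain_group_def bar_basis_def length_Suc_conv)
  ultimately show ?thesis
    by (simp add: coboundaries_def)
qed

text \<open>The local half of the argument: on \<open>A\<close> this cochain is the
  \<open>e\<close>-th power of the two-variable cocycle defined by \<open>\<phi>\<close>, and the
  elements of \<open>A\<close> inherit \<open>a^e = 1\<close> from \<open>G\<close>.\<close>

lemma hom_cochain_power_locally_coboundary:
  assumes G: "group G" and M: "comm_group M"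
    and div: "\<And>x k::nat. x \<in> carrier M \<Longrightarrow> k > 0 \<Longrightarrow> \<exists>y\<in>carrier M. y [^]\<^bsub>M\<^esub> k = x"
    and \<phi>: "\<phi> \<in> hom (bar_chain_group G 2) M"
    and van: "\<And>c. c \<in> integral_boundaries G 2 \<Longrightarrow> \<phi> c = \<one>\<^bsub>M\<^esub>"
    and exp: "\<And>g. g \<in> carrier G \<Longrightarrow> g [^]\<^bsub>G\<^esub> (e::nat) = \<one>\<^bsub>G\<^esub>"
    and A: "A \<in> abelian_subgroups G"
  shows "restrict (hom_cochain G 2 (\<lambda>c. \<phi> c [^]\<^bsub>M\<^esub> e)) (bar_basis (G\<lparr>carrier := A\<rparr>) 2)
    \<in> coboundaries (G\<lparr>carrier := A\<rparr>) M 2"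
proof -
  let ?H = "G\<lparr>carrier := A\<rparr>"
  interpret G: group G by fact
  have H: "comm_group ?H" and sub: "A \<subseteq> carrier G"
    using A by (auto simp: abelian_subgroups_def dest: subgroup.subset)
  have "cocycle2 G M (\<lambda>a b. \<phi> (frag_of [a, b]))"
    using hom_vanishing_on_boundaries_cocycle2[OF G M \<phi> van] .
  then have coc: "cocycle2 ?H M (\<lambda>a b. \<phi> (frag_of [a, b]))"
    using sub by (simp add: cocycle2_def subset_iff)
  have "a [^]\<^bsub>?H\<^esub> e = \<one>\<^bsub>?H\<^esub>" if "a \<in> carrier ?H" for a
    using that sub exp by (auto simp flip: G.nat_pow_consistent)
  from cocycle_power_is_coboundary[OF H M coc div this]
  obtain h where h: "h \<in> carrier ?H \<rightarrow> carrier M"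
    and eq: "\<forall>a\<in>carrier ?H. \<forall>b\<in>carrier ?H. \<phi> (frag_of [a, b]) [^]\<^bsub>M\<^esub> e =
      h b \<otimes>\<^bsub>M\<^esub> inv\<^bsub>M\<^esub> h (a \<otimes>\<^bsub>?H\<^esub> b) \<otimes>\<^bsub>M\<^esub> h a" ..
  show ?thesis
  proof (rule coboundary2I[OF comm_group.axioms(2)[OF H] M h])
    show "restrict (hom_cochain G 2 (\<lambda>c. \<phi> c [^]\<^bsub>M\<^esub> e)) (bar_basis ?H 2) [a, b] =
        h b \<otimes>\<^bsub>M\<^esub> inv\<^bsub>M\<^esub> h (a \<otimes>\<^bsub>?H\<^esub> b) \<otimes>\<^bsub>M\<^esub> h a"
      if "a \<in> carrier ?H" "b \<in> carrier ?H" for a b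
      using that eq sub by (auto simp: hom_cochain_def bar_basis_def)
  qed simp
qed

lemma exponent_multiple_cycle_is_boundary:
  assumes G: "group G"
    and triv: "bogomolov_multiplier G = {\<one>\<^bsub>cohomology_group G rat_mod_int_group 2\<^esub>}"
    and exp: "\<And>g. g \<in> carrier G \<Longrightarrow> g [^]\<^bsub>G\<^esub> (e::nat) = \<one>\<^bsub>G\<^esub>"
    and z: "z \<in> integral_cycles G 2"
  shows "z [^]\<^bsub>bar_chain_group G 2\<^esub> e \<in> integral_boundaries G 2"
proof (rule ccontr)
  let ?M = rat_mod_int_group and ?C = "bar_chain_group G 2"
  assume neg: "z [^]\<^bsub>?C\<^esub> e \<notin> integral_boundaries G 2"
  note M = comm_group_rat_mod_int
  interpret M: comm_group ?M by (rule M)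
  interpret C: comm_group ?C by (rule comm_group_bar_chain_group)
  have B: "subgroup (integral_boundaries G 2) ?C"
    by (rule integral_boundaries_subgroup[OF G])
  have zc: "z \<in> carrier ?C" using z by (simp add: integral_cycles_def kernel_def)
  \<comment> \<open>A homomorphism that is trivial on boundaries but detects
    \<open>z [^] e\<close>.\<close>
  obtain \<phi> where \<phi>: "\<phi> \<in> hom ?C ?M" and van: "\<And>c. c \<in> integral_boundaries G 2 \<Longrightarrow> \<phi> c = \<one>\<^bsub>?M\<^esub>"
    and ne: "\<phi> (z [^]\<^bsub>?C\<^esub> e) \<noteq> \<one>\<^bsub>?M\<^esub>"
    using rat_mod_int_hom_separates[OF C.comm_group_axioms B C.nat_pow_closed[OF zc] neg] by blast
  let ?\<psi> = "\<lambda>c. \<phi> c [^]\<^bsub>?M\<^esub> e"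
  have \<psi>: "?\<psi> \<in> hom ?C ?M"
    using \<phi> by (auto simp: hom_def Pi_def M.nat_pow_distrib)
  have "hom_cochain G 2 ?\<psi> \<in> coboundaries G ?M 2"
  proof (rule bogomolov_multiplier_trivialD[OF G triv])
    show "hom_cochain G 2 ?\<psi> \<in> cocycles G ?M 2"
      by (rule hom_cochain_cocycle[OF G M \<psi>]) (simp add: van)
  qed (rule hom_cochain_power_locally_coboundary[OF G M rat_mod_int_divisible \<phi> van exp])
  \<comment> \<open>A homomorphism whose cochain is a coboundary vanishes on cycles; but
    \<open>?\<psi> z\<close> equals \<open>\<phi>\<close> at \<open>z [^] e\<close>, which is
    nontrivial.\<close>
  then have "?\<psi> z = \<one>\<^bsub>?M\<^esub>"
    using hom_cochain_coboundary_vanishes[OF G M, of ?\<psi> 1 z] \<psi> z by (simp add: numeral_2_eq_2)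
  then show False
    using ne hom_nat_pow[OF \<phi> zc C.group_axioms M.group_axioms] by simp
qed

theorem lemma3p1:
  fixes G :: "('a, 'b) monoid_scheme"
  assumes "group G"
    and "finite (carrier G)"
    and "bogomolov_multiplier G = {\<one>\<^bsub>cohomology_group G rat_mod_int_group 2\<^esub>}"
  shows "group_exponent (integral_homology_group G 2) dvd group_exponent G"
proof -
  let ?C = "bar_chain_group G 2" and ?B = "integral_boundaries G 2" and ?e = "group_exponent G"
  interpret C: comm_group ?C by (rule comm_group_bar_chain_group)
  have B: "subgroup ?B ?C"
    by (rule integral_boundaries_subgroup[OF assms(1)])
  interpret B: normal ?B ?C
    using C.subgroup_imp_normal[OF B] .
  let ?S = "(\<lambda>z. ?B #>\<^bsub>?C\<^esub> z) ` integral_cycles G 2"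
  have cyc: "integral_cycles G 2 \<subseteq> carrier ?C"
    by (auto simp: integral_cycles_def kernel_def)
  \<comment> \<open>Cycles modulo boundaries use the same cosets and the same product as chains
    modulo boundaries, restricted to the classes of cycles, so powers can be computed in the ambient
    quotient.\<close>
  have "integral_homology_group G 2 = (?C Mod ?B)\<lparr>carrier := ?S\<rparr>"
    by (auto simp: integral_homology_group_def FactGroup_def RCOSETS_def r_coset_def
        set_mult_def fun_eq_iff)
  moreover have "group_exponent ((?C Mod ?B)\<lparr>carrier := ?S\<rparr>) dvd ?e"
  proof (rule group_exponent_dvd)
    show "group (?C Mod ?B)" by (rule B.factorgroup_is_group)
    show "?S \<subseteq> carrier (?C Mod ?B)"
      using cyc by (auto simp: FactGroup_def RCOSETS_def)
    show "?e > 0" using assms(1,2) by (rule group_exponent_finite)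
    show "g [^]\<^bsub>?C Mod ?B\<^esub> ?e = \<one>\<^bsub>?C Mod ?B\<^esub>" if g: "g \<in> ?S" for g
    proof -
      obtain z where z: "z \<in> integral_cycles G 2" and gz: "g = ?B #>\<^bsub>?C\<^esub> z" using g by auto
      have zc: "z \<in> carrier ?C" using cyc z by blast
      have "g [^]\<^bsub>?C Mod ?B\<^esub> ?e = ?B #>\<^bsub>?C\<^esub> (z [^]\<^bsub>?C\<^esub> ?e)"
        unfolding gz
        by (rule hom_nat_pow[OF B.r_coset_hom_Mod zc C.group_axioms B.factorgroup_is_group, symmetric])
      also have "\<dots> = ?B"
        using exponent_multiple_cycle_is_boundary[OF assms(1,3) group_exponent_finite(2)[OF assms(1,2)] z]
        by (rule B.rcos_const[OF C.group_axioms])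
      finally show ?thesis by (simp add: FactGroup_def)
    qed
  qed
  ultimately show ?thesis by simp
qed

end
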